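(* Let $\gamma\in\{1,-1\}$, $\sigma\in(0,3/2]$, and let $a_n>0$, $b_n\in\mathbb R$ satisfy, as $n\to\infty$, $$a_n=n^\sigma(1+\alpha n^{-1}+O(n^{-2})),\qquad b_n=2\gamma n^\sigma(1+\beta n^{-1}+O(n^{-2})),$$ with $\alpha,\beta\in\mathbb R$; put $\tau=2\beta-2\alpha+\sigma$. Let one of the following three assumptions be satisfied: $1^0$ $\sigma\in(1,3/2]$, $\tau<0$ and $\lambda\in\mathbb R$; $2^0$ $\sigma\in(0,1)$ and $\gamma\lambda>0$; $3^0$ $\sigma=1$ and $\gamma\lambda>\tau$. Let $P_n(\lambda)$ be the orthonormal polynomials with recurrence coefficients $a_n,b_n$. Then, as $n\to\infty$, $$P_n(\lambda)=\kappa(\lambda)w(\lambda)^{-1}(-\gamma)^nn^{-\rho}\sin\bigl(\Phi_n(\lambda)-\eta(\lambda)\bigr)\bigl(1+o(1)\bigr),$$ where $\rho$, $\Phi_n(\lambda)$, the Wronskian $w(\lambda)>0$, and the amplitude $\kappa(\lambda)$ and phase $\eta(\lambda)$ are defined in the context.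
   Context: $P_n$ are defined by $P_{-1}=0$, $P_0=1$, $a_{n-1}P_{n-1}(\lambda)+b_nP_n(\lambda)+a_nP_{n+1}(\lambda)=\lambda P_n(\lambda)$, $n\ge0$. $\rho=\sigma/2-1/4$ if $\sigma\ge1$, $\rho=\sigma/4$ if $\sigma\le1$. For $n\ge1$ put $t_n(z)=-\tau n^{-1}+zn^{-\sigma}$; $T_n=t_n$ if $\sigma\ge1$, and if $\sigma<1$, $T_n=t_n+\sum_{l=2}^Lp_lt_n^l$, where $L\ge1$ is a fixed integer with $(L+1/2)\sigma>1$ and the real numbers $p_2,\dots,p_L$ are determined by the requirement that, with $c_k=2(-1)^{k+1}/(2k)!$ and $P(t)=\sum_{l=2}^Lp_lt^l$, the polynomial $P(t)+\sum_{k=2}^Lc_k(P(t)+t)^k$ has no terms of degree $\le L$. For large $n$, $T_n(\gamma\lambda)>0$. Fix $N=N(\lambda)$ such that $T_m(\gamma\lambda)>0$ for $m\ge N$ and put $\Phi_n(\lambda)=\gamma\sum_{m=N}^n\sqrt{T_m(\gamma\lambda)}$ (positive roots); this is the phase $\varphi_n(\gamma(\lambda+i0))$, $\varphi_n(z)=\sum_{m=N}^n\sqrt{T_m(z)}$ with $\Im\sqrt{\cdot}\ge0$. The Jost solution $f_n(\lambda+i0)$ is the solution of $a_{n-1}F_{n-1}+b_nF_n+a_nF_{n+1}=\lambda F_n$, $n\ge1$, with $f_n(\lambda+i0)=(-\gamma)^nn^{-\rho}e^{i\Phi_n(\lambda)}(1+o(1))$ as $n\to\infty$ (it exists), and $f_n(\lambda-i0)=\overline{f_n(\lambda+i0)}$.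 The Wronskian of two solutions is $W[f,g]=a_n(f_ng_{n+1}-f_{n+1}g_n)$ (independent of $n$). Put $\Omega(\lambda\pm i0)=W[P(\lambda),f(\lambda\pm i0)]$, $\kappa(\lambda)=|\Omega(\lambda+i0)|$, and define $\eta(\lambda)$ (modulo $2\pi$) by $\Omega(\lambda\pm i0)=\kappa(\lambda)e^{\pm i\eta(\lambda)}$. Finally $w(\lambda)=\frac1{2i}W[f(\lambda+i0),f(\lambda-i0)]$, which equals $\sqrt{|\tau|}$ in case $1^0$, $\sqrt{\gamma\lambda}$ in case $2^0$, $\sqrt{\gamma\lambda-\tau}$ in case $3^0$.
   Formalization: The factor sin(Φ_n−η)(1+o(1)) is replaced by sin(Φ_n−η)+o(1), an error relative to the amplitude; the multiplicative form is false near zeros of the sine (e.g. Laguerre polynomials, σ=1, τ=0, generic λ>0). *)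

theory Defs
  imports "HOL-Analysis.Analysis" "HOL-Library.Landau_Symbols"
    "HOL-Computational_Algebra.Polynomial"
begin

text \<open>
  The coefficients of a Jacobi matrix are sequences \<open>a\<close>, \<open>b\<close> indexed from \<open>0\<close>;
  the spectral parameter is called \<open>x\<close>.
\<close>

text \<open>The values at \<open>x\<close> of the orthonormal polynomials: the convention \<open>P\<^sub>-\<^sub>1 = 0\<close> is built into
  the equation for \<open>P\<^sub>1\<close>, and the recurrence is solved for its highest term.\<close>

fun orthopoly :: "(nat \<Rightarrow> real) \<Rightarrow> (nat \<Rightarrow> real) \<Rightarrow> real \<Rightarrow> nat \<Rightarrow> real" where
  "orthopoly a b x 0 = 1"
| "orthopoly a b x (Suc 0) = (x - b 0) / a 0"
| "orthopoly a b x (Suc (Suc n)) =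
     ((x - b (Suc n)) * orthopoly a b x (Suc n) - a n * orthopoly a b x n) / a (Suc n)"

definition jacobi_solution ::
  "(nat \<Rightarrow> real) \<Rightarrow> (nat \<Rightarrow> real) \<Rightarrow> real \<Rightarrow> (nat \<Rightarrow> complex) \<Rightarrow> bool" where
  "jacobi_solution a b x F \<longleftrightarrow>
     (\<forall>n\<ge>1. of_real (a (n - 1)) * F (n - 1) + of_real (b n) * F n + of_real (a n) * F (n + 1)
              = of_real x * F n)"

definition rho :: "real \<Rightarrow> real" where
  "rho \<sigma> = (if \<sigma> \<ge> 1 then \<sigma> / 2 - 1 / 4 else \<sigma> / 4)"

definition small_t :: "real \<Rightarrow> real \<Rightarrow> nat \<Rightarrow> real \<Rightarrow> real" where
  "small_t \<sigma> \<tau> n z = - \<tau> / real n + z * real n powr (- \<sigma>)"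

definition cos_coeff2 :: "nat \<Rightarrow> real" where
  "cos_coeff2 k = 2 * (- 1) ^ (k + 1) / fact (2 * k)"

definition is_corr_poly :: "nat \<Rightarrow> real poly \<Rightarrow> bool" where
  "is_corr_poly L p \<longleftrightarrow>
     degree p \<le> L \<and> coeff p 0 = 0 \<and> coeff p 1 = 0 \<and>
     (\<forall>j\<le>L. coeff (p + (\<Sum>k=2..L. smult (cos_coeff2 k) ((p + [:0, 1:]) ^ k))) j = 0)"

text \<open>The conditions determine the coefficients of degree \<open>2, \<dots>, L\<close> successively and uniquely.\<close>

definition corr_poly :: "nat \<Rightarrow> real poly" where
  "corr_poly L = (THE p. is_corr_poly L p)"

definition big_T :: "real \<Rightarrow> real \<Rightarrow> nat \<Rightarrow> nat \<Rightarrow> real \<Rightarrow> real" where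
  "big_T \<sigma> \<tau> L n z =
     (if \<sigma> \<ge> 1 then small_t \<sigma> \<tau> n z
      else small_t \<sigma> \<tau> n z + poly (corr_poly L) (small_t \<sigma> \<tau> n z))"

text \<open>For real \<open>x\<close> the phase uses positive square roots. The prefactor \<open>\<gamma> = \<plusminus>1\<close> is the sign of the
  boundary value on the real axis, taken from the side of \<open>\<gamma>(x + i0)\<close>, of the branch of the square
  root with nonnegative imaginary part.\<close>

definition jost_phase ::
  "real \<Rightarrow> real \<Rightarrow> real \<Rightarrow> nat \<Rightarrow> nat \<Rightarrow> real \<Rightarrow> nat \<Rightarrow> real" where
  "jost_phase \<gamma> \<sigma> \<tau> L N x n = \<gamma> * (\<Sum>m=N..n. sqrt (big_T \<sigma> \<tau> L m (\<gamma> * x)))"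

definition is_jost ::
  "real \<Rightarrow> real \<Rightarrow> real \<Rightarrow> nat \<Rightarrow> nat \<Rightarrow> (nat \<Rightarrow> real) \<Rightarrow> (nat \<Rightarrow> real) \<Rightarrow> real \<Rightarrow> (nat \<Rightarrow> complex) \<Rightarrow> bool"
  where
  "is_jost \<gamma> \<sigma> \<tau> L N a b x F \<longleftrightarrow>
     jacobi_solution a b x F \<and>
     F \<sim>[sequentially]
       (\<lambda>n. of_real ((- \<gamma>) ^ n * real n powr (- rho \<sigma>)) *
             exp (\<i> * of_real (jost_phase \<gamma> \<sigma> \<tau> L N x n)))"

text \<open>The boundary values of the Jost solution at \<open>x + i0\<close> and \<open>x - i0\<close>. The first one is given by
  a definite description: nothing can be derived about it without proving that there is exactly one
  solution with the prescribed asymptotics.\<close>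

definition jost_plus ::
  "real \<Rightarrow> real \<Rightarrow> real \<Rightarrow> nat \<Rightarrow> nat \<Rightarrow> (nat \<Rightarrow> real) \<Rightarrow> (nat \<Rightarrow> real) \<Rightarrow> real \<Rightarrow> nat \<Rightarrow> complex" where
  "jost_plus \<gamma> \<sigma> \<tau> L N a b x = (THE F. is_jost \<gamma> \<sigma> \<tau> L N a b x F)"

definition jost_minus ::
  "real \<Rightarrow> real \<Rightarrow> real \<Rightarrow> nat \<Rightarrow> nat \<Rightarrow> (nat \<Rightarrow> real) \<Rightarrow> (nat \<Rightarrow> real) \<Rightarrow> real \<Rightarrow> nat \<Rightarrow> complex" where
  "jost_minus \<gamma> \<sigma> \<tau> L N a b x n = cnj (jost_plus \<gamma> \<sigma> \<tau> L N a b x n)"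

text \<open>For two solutions the expression \<open>a\<^sub>n (f\<^sub>n g\<^sub>n\<^sub>+\<^sub>1 - f\<^sub>n\<^sub>+\<^sub>1 g\<^sub>n)\<close> does not depend on \<open>n \<ge> 0\<close>;
  it is evaluated at \<open>n = 0\<close>.\<close>

definition wronskian :: "(nat \<Rightarrow> real) \<Rightarrow> (nat \<Rightarrow> complex) \<Rightarrow> (nat \<Rightarrow> complex) \<Rightarrow> complex" where
  "wronskian a f g = of_real (a 0) * (f 0 * g 1 - f 1 * g 0)"

definition Omega_plus ::
  "real \<Rightarrow> real \<Rightarrow> real \<Rightarrow> nat \<Rightarrow> nat \<Rightarrow> (nat \<Rightarrow> real) \<Rightarrow> (nat \<Rightarrow> real) \<Rightarrow> real \<Rightarrow> complex" where
  "Omega_plus \<gamma> \<sigma> \<tau> L N a b x =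
     wronskian a (\<lambda>n. of_real (orthopoly a b x n)) (jost_plus \<gamma> \<sigma> \<tau> L N a b x)"

definition Omega_minus ::
  "real \<Rightarrow> real \<Rightarrow> real \<Rightarrow> nat \<Rightarrow> nat \<Rightarrow> (nat \<Rightarrow> real) \<Rightarrow> (nat \<Rightarrow> real) \<Rightarrow> real \<Rightarrow> complex" where
  "Omega_minus \<gamma> \<sigma> \<tau> L N a b x =
     wronskian a (\<lambda>n. of_real (orthopoly a b x n)) (jost_minus \<gamma> \<sigma> \<tau> L N a b x)"

definition kappa ::
  "real \<Rightarrow> real \<Rightarrow> real \<Rightarrow> nat \<Rightarrow> nat \<Rightarrow> (nat \<Rightarrow> real) \<Rightarrow> (nat \<Rightarrow> real) \<Rightarrow> real \<Rightarrow> real" where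
  "kappa \<gamma> \<sigma> \<tau> L N a b x = cmod (Omega_plus \<gamma> \<sigma> \<tau> L N a b x)"

text \<open>The phase \<open>\<eta>\<close> is only defined modulo \<open>2\<pi>\<close>, hence a relation.\<close>

definition is_eta ::
  "real \<Rightarrow> real \<Rightarrow> real \<Rightarrow> nat \<Rightarrow> nat \<Rightarrow> (nat \<Rightarrow> real) \<Rightarrow> (nat \<Rightarrow> real) \<Rightarrow> real \<Rightarrow> real \<Rightarrow> bool" where
  "is_eta \<gamma> \<sigma> \<tau> L N a b x \<eta> \<longleftrightarrow>
     Omega_plus \<gamma> \<sigma> \<tau> L N a b x = of_real (kappa \<gamma> \<sigma> \<tau> L N a b x) * exp (\<i> * of_real \<eta>) \<and>
     Omega_minus \<gamma> \<sigma> \<tau> L N a b x = of_real (kappa \<gamma> \<sigma> \<tau> L N a b x) * exp (- \<i> * of_real \<eta>)"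

text \<open>The Wronskian of a sequence with its complex conjugate is purely imaginary, so taking the real
  part only converts the type.\<close>

definition jost_w ::
  "real \<Rightarrow> real \<Rightarrow> real \<Rightarrow> nat \<Rightarrow> nat \<Rightarrow> (nat \<Rightarrow> real) \<Rightarrow> (nat \<Rightarrow> real) \<Rightarrow> real \<Rightarrow> real" where
  "jost_w \<gamma> \<sigma> \<tau> L N a b x =
     Re (wronskian a (jost_plus \<gamma> \<sigma> \<tau> L N a b x) (jost_minus \<gamma> \<sigma> \<tau> L N a b x) / (2 * \<i>))"

text \<open>Asymptotics of the form \<open>P\<^sub>n = A\<^sub>n sin \<theta>\<^sub>n (1 + o(1))\<close> are understood in the usual sense for
  oscillating sequences, \<open>P\<^sub>n = A\<^sub>n (sin \<theta>\<^sub>n + o(1))\<close>: the error is relative to the amplitude \<open>A\<^sub>n\<close>.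
  An error relative to \<open>sin \<theta>\<^sub>n\<close> itself would force \<open>P\<^sub>n\<close> and \<open>A\<^sub>n sin \<theta>\<^sub>n\<close> to have the same sign for
  all large \<open>n\<close>. This fails for Laguerre polynomials, where the next term of the phase and the
  increments of \<open>\<theta>\<^sub>n\<close> are both of the order \<open>n\<^sup>-\<^sup>1\<^sup>/\<^sup>2\<close>.\<close>

end

theory Submission
  imports Defs "HOL-Real_Asymp.Real_Asymp"
begin

text \<open>Write \<open>\<theta>\<^sub>n\<close> for the square root of the \<open>n\<close>-th value of \<open>big_T\<close>, so that \<open>\<gamma> \<theta>\<^sub>n\<close> is the increment of the phase, and let
\<open>Q\<^sub>n = (-\<gamma>)\<^sup>n n powr (-\<rho>) exp (\<i> \<Phi>\<^sub>n)\<close> be the explicit sequence that the Jost solution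
is required to follow. The proof compares an arbitrary solution \<open>u\<close> of the recurrence with \<open>Q\<close> and its
conjugate by means of the Casoratians \<open>{u,Q}\<^sub>n = a\<^sub>n (u\<^sub>n Q\<^sub>n\<^sub>+\<^sub>1 - u\<^sub>n\<^sub>+\<^sub>1 Q\<^sub>n)\<close>
and \<open>{u,cnj Q}\<^sub>n\<close>. Three facts carry the proof.

\<^item> The defect \<open>E\<^sub>n\<close> of \<open>Q\<close>, that is, what is left when \<open>Q\<close> is put into the recurrence, satisfies
\<open>|Q\<^sub>n E\<^sub>n| = O(n powr (-1 - \<epsilon>))\<close> (lemmas \<open>ansatz_error_estimate\<close> and \<open>jacobi_ansatz_jost\<close>). After
division by \<open>Q\<^sub>n\<close> and the leading power of \<open>n\<close>, the real part of \<open>E\<^sub>n\<close> is small because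
\<open>2 cos \<theta>\<^sub>n - 2\<close> cancels against \<open>t\<^sub>n\<close>: the polynomial correction in the definition of \<open>big_T\<close> exists
for this purpose. The imaginary part is small because the exponent \<open>\<rho>\<close> is tuned so that the
decay of the amplitude compensates the slow change of \<open>\<theta>\<^sub>n\<close> and of the coefficients.

\<^item> \<open>{Q,cnj Q}\<^sub>n\<close> tends to \<open>2\<i> w\<close> with \<open>w > 0\<close>. Hence \<open>u\<^sub>n\<close> is recovered from \<open>{u,Q}\<^sub>n\<close> and
\<open>{u,cnj Q}\<^sub>n\<close> by Cramer's rule, while these two numbers change in one step by
\<open>u\<^sub>n\<^sub>+\<^sub>1 E\<^sub>n\<^sub>+\<^sub>1\<close> and \<open>u\<^sub>n\<^sub>+\<^sub>1 cnj E\<^sub>n\<^sub>+\<^sub>1\<close>. A discrete Gronwall argument shows that both converge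
(\<open>casoratians_converge\<close>). The Pluecker relation between Casoratians makes the pair of limits a
linear isomorphism from solutions to pairs of complex numbers, and turns Wronskians into determinants
of limits (\<open>wronskian_limits\<close>).

\<^item> \<open>cnj Q\<^sub>n / Q\<^sub>n = exp (-2\<i> \<Phi>\<^sub>n)\<close> has no limit, since the phase diverges with increments
tending to \<open>0\<close>. Therefore \<open>u \<sim> Q\<close> holds exactly for the solution with limits \<open>0\<close> and \<open>2\<i> w\<close>, which
gives existence and uniqueness of the Jost solution \<open>f\<close> (\<open>ex1_jost\<close>), the value \<open>2\<i> w\<close> of its
Wronskian with its conjugate, and the equality of \<open>lim {u,Q}\<^sub>n\<close> with the Wronskian of \<open>u\<close> and \<open>f\<close>.

For \<open>u = P\<close> the second Casoratian is the conjugate of the first, whose limit is \<open>\<Omega> = \<kappa> exp (\<i> \<eta>)\<close>;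
Cramer's rule becomes \<open>P\<^sub>n = - Im ({P,Q}\<^sub>n cnj Q\<^sub>n) / w\<^sub>n\<close> with \<open>w\<^sub>n\<close> tending to \<open>w\<close>, and
this is the asserted sine law. If \<open>\<kappa>\<close> vanished, both limits would be \<open>0\<close> and \<open>P\<close> would vanish identically.\<close>

section \<open>Solutions of the Jacobi recurrence and their Casoratians\<close>

text \<open>The second argument need not solve the recurrence, and then the expression depends on \<open>n\<close>.\<close>

definition casoratian :: "(nat \<Rightarrow> real) \<Rightarrow> (nat \<Rightarrow> complex) \<Rightarrow> (nat \<Rightarrow> complex) \<Rightarrow> nat \<Rightarrow> complex" where
  "casoratian a f g n = of_real (a n) * (f n * g (Suc n) - f (Suc n) * g n)"

definition defect :: "(nat \<Rightarrow> real) \<Rightarrow> (nat \<Rightarrow> real) \<Rightarrow> real \<Rightarrow> (nat \<Rightarrow> complex) \<Rightarrow> nat \<Rightarrow> complex" where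
  "defect a b x G n =
     of_real (a (n - 1)) * G (n - 1) + of_real (b n) * G n + of_real (a n) * G (Suc n) - of_real x * G n"

lemma casoratian_0: "casoratian a f g 0 = wronskian a f g"
  by (simp add: casoratian_def wronskian_def)

text \<open>The values at \<open>n + 2\<close> are eliminated, for \<open>u\<close> by the recurrence and for \<open>G\<close> by the definition of the
defect; the diagonal terms are symmetric in \<open>u\<close> and \<open>G\<close> and cancel, so that only the defect of \<open>G\<close> survives.\<close>

lemma casoratian_step:
  assumes "jacobi_solution a b x u"
  shows "casoratian a u G (Suc n) - casoratian a u G n = u (Suc n) * defect a b x G (Suc n)"
proof -
  have "of_real (a n) * u n + of_real (b (Suc n)) * u (Suc n) + of_real (a (Suc n)) * u (Suc (Suc n))
      = of_real x * u (Suc n)"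
    using assms unfolding jacobi_solution_def by (metis Suc_eq_plus1 diff_Suc_1 le_add2)
  then have "of_real (a (Suc n)) * u (Suc (Suc n)) =
      of_real x * u (Suc n) - of_real (a n) * u n - of_real (b (Suc n)) * u (Suc n)"
    by (simp add: algebra_simps)
  moreover have "casoratian a u G (Suc n) - casoratian a u G n - u (Suc n) * defect a b x G (Suc n) =
    - (of_real (a (Suc n)) * u (Suc (Suc n)) -
      (of_real x * u (Suc n) - of_real (a n) * u n - of_real (b (Suc n)) * u (Suc n))) * G (Suc n)"
    by (simp add: casoratian_def defect_def algebra_simps)
  ultimately show ?thesis by simp
qed

lemma defect_solution: "jacobi_solution a b x G \<Longrightarrow> defect a b x G (Suc n) = 0"
  unfolding defect_def jacobi_solution_def
  by (metis Suc_eq_plus1 eq_iff_diff_eq_0 le_add2)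

lemma casoratian_solutions:
  assumes "jacobi_solution a b x u" "jacobi_solution a b x v"
  shows "casoratian a u v n = wronskian a u v"
  using casoratian_step[OF assms(1), of v] defect_solution[OF assms(2)]
  by (induction n) (auto simp: casoratian_0)

text \<open>The Pluecker relation for four vectors in the plane, here the pairs of consecutive values.\<close>

lemma casoratian_pluecker:
  "casoratian a u v n * casoratian a p q n =
     casoratian a u p n * casoratian a v q n - casoratian a u q n * casoratian a v p n"
  by (simp add: casoratian_def algebra_simps)

text \<open>Cramer's rule: \<open>p\<close> and \<open>q\<close> play the role of a basis in which \<open>u\<close> is expanded. The version at
\<open>Suc n\<close> uses the same Casoratians, which is what a recursive estimate needs.\<close>

lemma casoratian_reconstruct:
  "u n * casoratian a p q n = casoratian a u q n * p n - casoratian a u p n * q n"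
  "u (Suc n) * casoratian a p q n = casoratian a u q n * p (Suc n) - casoratian a u p n * q (Suc n)"
  by (simp_all add: casoratian_def algebra_simps)

lemma defect_cnj: "defect a b x (\<lambda>n. cnj (G n)) n = cnj (defect a b x G n)"
  by (simp add: defect_def)

lemma jacobi_solution_cnj:
  assumes "jacobi_solution a b x F" shows "jacobi_solution a b x (\<lambda>n. cnj (F n))"
  unfolding jacobi_solution_def
proof (intro allI impI)
  fix n :: nat assume "1 \<le> n"
  then have "cnj (of_real (a (n - 1)) * F (n - 1) + of_real (b n) * F n + of_real (a n) * F (n + 1))
     = cnj (of_real x * F n)" using assms by (auto simp: jacobi_solution_def)
  then show "of_real (a (n - 1)) * cnj (F (n - 1)) + of_real (b n) * cnj (F n)
     + of_real (a n) * cnj (F (n + 1)) = of_real x * cnj (F n)" by simp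
qed

lemma jacobi_solution_lincomb:
  assumes "jacobi_solution a b x F" "jacobi_solution a b x G"
  shows "jacobi_solution a b x (\<lambda>n. c * F n + d * G n)"
  unfolding jacobi_solution_def
proof (intro allI impI)
  fix n :: nat assume n: "1 \<le> n"
  have "of_real (a (n - 1)) * F (n - 1) + of_real (b n) * F n + of_real (a n) * F (n + 1) = of_real x * F n"
    "of_real (a (n - 1)) * G (n - 1) + of_real (b n) * G n + of_real (a n) * G (n + 1) = of_real x * G n"
    using assms n by (auto simp: jacobi_solution_def)
  then show "of_real (a (n - 1)) * (c * F (n - 1) + d * G (n - 1)) + of_real (b n) * (c * F n + d * G n)
     + of_real (a n) * (c * F (n + 1) + d * G (n + 1)) = of_real x * (c * F n + d * G n)"
    by algebra
qed

lemma casoratian_lincomb: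
  "casoratian a (\<lambda>n. c * F n + d * G n) H n = c * casoratian a F H n + d * casoratian a G H n"
  by (simp add: casoratian_def algebra_simps)

text \<open>The solutions with arbitrary complex initial values; they supply a basis of the solution space.\<close>

fun jacobi_iterate ::
  "(nat \<Rightarrow> real) \<Rightarrow> (nat \<Rightarrow> real) \<Rightarrow> real \<Rightarrow> complex \<Rightarrow> complex \<Rightarrow> nat \<Rightarrow> complex" where
  "jacobi_iterate a b x c d 0 = c"
| "jacobi_iterate a b x c d (Suc 0) = d"
| "jacobi_iterate a b x c d (Suc (Suc n)) =
     ((of_real x - of_real (b (Suc n))) * jacobi_iterate a b x c d (Suc n)
       - of_real (a n) * jacobi_iterate a b x c d n) / of_real (a (Suc n))"

lemma jacobi_solution_iterate:
  assumes "\<And>n. a n > 0" shows "jacobi_solution a b x (jacobi_iterate a b x c d)"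
  unfolding jacobi_solution_def
proof (intro allI impI)
  fix n :: nat assume "1 \<le> n"
  then obtain m where "n = Suc m" by (cases n) auto
  moreover have "a (Suc m) \<noteq> 0" using assms[of "Suc m"] by simp
  ultimately show "of_real (a (n - 1)) * jacobi_iterate a b x c d (n - 1)
     + of_real (b n) * jacobi_iterate a b x c d n
     + of_real (a n) * jacobi_iterate a b x c d (n + 1) = of_real x * jacobi_iterate a b x c d n"
    by (simp add: diff_divide_distrib algebra_simps) (simp add: field_simps)
qed

lemma jacobi_solution_orthopoly:
  assumes "\<And>n. a n > 0" shows "jacobi_solution a b x (\<lambda>n. of_real (orthopoly a b x n))"
proof -
  have "jacobi_iterate a b x 1 (of_real ((x - b 0) / a 0)) n = of_real (orthopoly a b x n)" for n
    by (induction n rule: induct_nat_012) auto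
  then have "jacobi_iterate a b x 1 (of_real ((x - b 0) / a 0)) = (\<lambda>n. of_real (orthopoly a b x n))"
    by (rule ext)
  then show ?thesis
    using jacobi_solution_iterate[of a b x 1 "of_real ((x - b 0) / a 0)", OF assms] by metis
qed

lemma jacobi_solution_eqI:
  assumes a: "\<And>n. a n > 0" and "jacobi_solution a b x F" "jacobi_solution a b x G"
    and "F 0 = G 0" "F 1 = G 1"
  shows "F = G"
proof
  have F: "F n = jacobi_iterate a b x (H 0) (H 1) n" if "jacobi_solution a b x F" "F 0 = H 0" "F 1 = H 1"
    for F H :: "nat \<Rightarrow> complex" and n
  proof (induction n rule: induct_nat_012)
    case (ge2 n)
    have "a (Suc n) \<noteq> 0" using a[of "Suc n"] by simp
    moreover have "of_real (a n) * F n + of_real (b (Suc n)) * F (Suc n) + of_real (a (Suc n)) * F (Suc (Suc n))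
      = of_real x * F (Suc n)"
      using that(1) unfolding jacobi_solution_def by (metis Suc_eq_plus1 diff_Suc_1 le_add2)
    ultimately have "F (Suc (Suc n)) = ((of_real x - of_real (b (Suc n))) * F (Suc n) - of_real (a n) * F n)
       / of_real (a (Suc n))"
      by (simp add: field_simps)
    then show ?case by (simp only: ge2 jacobi_iterate.simps)
  qed (use that in auto)
  show "F n = G n" for n using F[of F G n] F[of G G n] assms by simp
qed

section \<open>Approximate solutions with absolutely summable defect\<close>

text \<open>Discrete Gronwall argument: a step multiplies the norm by at most \<open>1 + r\<^sub>n \<le> exp r\<^sub>n\<close>, so the
sequence is bounded, and then its increments are dominated by a multiple of \<open>r\<close>.\<close>

lemma convergent_of_summable_relative_increments:
  fixes V :: "nat \<Rightarrow> 'a::banach"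
  assumes inc: "\<forall>\<^sub>F n in sequentially. norm (V (Suc n) - V n) \<le> r n * norm (V n)"
    and sum: "summable r" and nn: "\<And>n. r n \<ge> 0"
  shows "convergent V"
proof -
  obtain M where M: "\<And>n. n \<ge> M \<Longrightarrow> norm (V (Suc n) - V n) \<le> r n * norm (V n)"
    using inc by (auto simp: eventually_sequentially)
  have bd: "norm (V (M + k)) \<le> norm (V M) * exp (\<Sum>i<k. r (M + i))" for k
  proof (induction k)
    case (Suc k)
    have "norm (V (M + Suc k)) \<le> norm (V (M + k)) + norm (V (Suc (M + k)) - V (M + k))"
      by (metis add_Suc_right norm_triangle_sub)
    also have "\<dots> \<le> norm (V (M + k)) + r (M + k) * norm (V (M + k))"
      using M[of "M + k"] by simp
    also have "\<dots> = norm (V (M + k)) * (1 + r (M + k))" by (simp add: algebra_simps)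
    also have "\<dots> \<le> (norm (V M) * exp (\<Sum>i<k. r (M + i))) * exp (r (M + k))"
      by (intro mult_mono Suc.IH exp_ge_add_one_self) (use nn[of "M + k"] in auto)
    also have "\<dots> = norm (V M) * exp (\<Sum>i<Suc k. r (M + i))" by (simp add: exp_add)
    finally show ?case .
  qed simp
  have sM: "summable (\<lambda>i. r (M + i))" using sum summable_iff_shift[of r M] by (simp add: add.commute)
  define B where "B = norm (V M) * exp (\<Sum>i. r (M + i))"
  have bd2: "norm (V (M + k)) \<le> B" for k
  proof -
    have "(\<Sum>i<k. r (M + i)) \<le> (\<Sum>i. r (M + i))"
      using sM nn by (intro sum_le_suminf) auto
    then show ?thesis using bd[of k] unfolding B_def
      by (smt (verit) exp_le_cancel_iff mult_left_mono norm_ge_zero)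
  qed
  have "summable (\<lambda>k. V (Suc (M + k)) - V (M + k))"
  proof (rule summable_comparison_test')
    show "summable (\<lambda>k. r (M + k) * B)" using sM by (rule summable_mult2)
    show "norm (V (Suc (M + k)) - V (M + k)) \<le> r (M + k) * B" if "k \<ge> 0" for k
      using M[of "M + k"] bd2[of k] nn[of "M + k"] mult_left_mono order_trans by fastforce
  qed
  then have "convergent (\<lambda>k. \<Sum>i<k. V (Suc (M + i)) - V (M + i))"
    by (simp add: summable_iff_convergent)
  moreover have "(\<Sum>i<k. V (Suc (M + i)) - V (M + i)) = V (M + k) - V M" for k
    by (induction k) auto
  ultimately have "convergent (\<lambda>k. V (M + k) - V M)" by simp
  then have "convergent (\<lambda>k. (V (M + k) - V M) + V M)" by (rule convergent_add[OF _ convergent_const])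
  then have "convergent (\<lambda>k. V (k + M))" by (simp add: add.commute)
  then show ?thesis using convergent_ignore_initial_segment by blast
qed

text \<open>What is needed of an approximate solution \<open>Q\<close> in order that it and its conjugate serve as a basis
at infinity: \<open>D_lim\<close> makes the two asymptotically independent, with a constant that will turn out to be
the Wronskian of the Jost solution; \<open>defect_sum\<close> makes the perturbation absolutely summable after
expansion in this basis; \<open>osc\<close> prevents the conjugate solution from imitating \<open>Q\<close> up to a constant factor,
which is the source of uniqueness.\<close>

locale jacobi_ansatz =
  fixes a b :: "nat \<Rightarrow> real" and x :: real and Q :: "nat \<Rightarrow> complex" and w :: real
  assumes a_pos: "\<And>n. a n > 0"
    and w_pos: "w > 0"
    and Q_nz: "\<forall>\<^sub>F n in sequentially. Q n \<noteq> 0"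
    and D_lim: "casoratian a Q (\<lambda>n. cnj (Q n)) \<longlonglongrightarrow> 2 * \<i> * of_real w"
    and defect_sum: "summable (\<lambda>n. norm (Q n) * norm (defect a b x Q n))"
    and osc: "\<not> convergent (\<lambda>n. cnj (Q n) / Q n)"
begin

abbreviation "cQ \<equiv> \<lambda>n. cnj (Q n)"
abbreviation "D \<equiv> casoratian a Q cQ"

lemma D_lim_nz: "2 * \<i> * of_real w \<noteq> (0::complex)" using w_pos by simp

lemma D_nz: "\<forall>\<^sub>F n in sequentially. D n \<noteq> 0"
  using tendsto_imp_eventually_ne[OF D_lim D_lim_nz] .

text \<open>By Cramer's rule \<open>u\<^sub>n\<^sub>+\<^sub>1\<close> is at most of the size of \<open>Q\<^sub>n\<^sub>+\<^sub>1\<close> times the two Casoratians at \<open>n\<close>, so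
both change by a summable fraction of their joint size and the Gronwall argument applies.\<close>

lemma casoratians_converge:
  assumes u: "jacobi_solution a b x u"
  shows "\<exists>p q. casoratian a u Q \<longlonglongrightarrow> p \<and> casoratian a u cQ \<longlonglongrightarrow> q"
proof -
  define V where "V n = (casoratian a u Q n, casoratian a u cQ n)" for n
  define e where "e n = norm (Q (Suc n)) * norm (defect a b x Q (Suc n))" for n
  have e: "summable e" unfolding e_def using defect_sum by (subst summable_Suc_iff)
  have "(\<lambda>n. norm (D n)) \<longlonglongrightarrow> norm (2 * \<i> * of_real w :: complex)"
    by (rule tendsto_norm[OF D_lim])
  then have "(\<lambda>n. norm (D n)) \<longlonglongrightarrow> 2 * w" using w_pos by (simp add: norm_mult)
  then have Dw: "\<forall>\<^sub>F n in sequentially. norm (D n) > w"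
    using w_pos by (intro order_tendstoD) auto
  have "convergent V"
  proof (rule convergent_of_summable_relative_increments)
    show "summable (\<lambda>n. 4 / w * e n)" using e by (rule summable_mult)
    show "4 / w * e n \<ge> 0" for n using w_pos by (simp add: e_def)
    show "\<forall>\<^sub>F n in sequentially. norm (V (Suc n) - V n) \<le> 4 / w * e n * norm (V n)"
      using Dw
    proof eventually_elim
      case (elim n)
      let ?p = "casoratian a u Q n" and ?q = "casoratian a u cQ n"
      have pq: "norm ?p \<le> norm (V n)" "norm ?q \<le> norm (V n)"
        using norm_fst_le[of ?p ?q] norm_snd_le[of ?q ?p] by (auto simp: V_def)
      have "norm (u (Suc n)) * norm (D n) = norm (?q * Q (Suc n) - ?p * cQ (Suc n))"
        by (metis casoratian_reconstruct(2) norm_mult)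
      also have "\<dots> \<le> norm ?q * norm (Q (Suc n)) + norm ?p * norm (Q (Suc n))"
        by (metis norm_triangle_ineq4 norm_mult complex_mod_cnj)
      also have "\<dots> \<le> norm (V n) * norm (Q (Suc n)) + norm (V n) * norm (Q (Suc n))"
        by (intro add_mono mult_right_mono pq) auto
      finally have "norm (u (Suc n)) * norm (D n) \<le> 2 * norm (V n) * norm (Q (Suc n))" by simp
      moreover have "norm (u (Suc n)) * w \<le> norm (u (Suc n)) * norm (D n)"
        using elim by (intro mult_left_mono) auto
      ultimately have un: "norm (u (Suc n)) \<le> 2 / w * norm (V n) * norm (Q (Suc n))"
        using w_pos by (simp add: field_simps)
      have "norm (V (Suc n) - V n) \<le> norm (casoratian a u Q (Suc n) - ?p) + norm (casoratian a u cQ (Suc n) - ?q)"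
        by (simp add: V_def norm_Pair_le)
      also have "\<dots> = 2 * (norm (u (Suc n)) * norm (defect a b x Q (Suc n)))"
        unfolding casoratian_step[OF u] by (simp add: norm_mult defect_cnj)
      also have "\<dots> \<le> 2 * ((2 / w * norm (V n) * norm (Q (Suc n))) * norm (defect a b x Q (Suc n)))"
        by (intro mult_left_mono mult_right_mono un) auto
      finally show ?case by (simp add: e_def mult_ac)
    qed
  qed
  then obtain l where "V \<longlonglongrightarrow> l" by (auto simp: convergent_def)
  then show ?thesis
    using tendsto_fst[of V l] tendsto_snd[of V l] unfolding V_def by auto
qed

text \<open>The limit of the Pluecker relation: the left-hand factor does not depend on \<open>n\<close>.\<close>

lemma wronskian_limits:
  assumes "jacobi_solution a b x u" "jacobi_solution a b x v"
    and "casoratian a u Q \<longlonglongrightarrow> p" "casoratian a u cQ \<longlonglongrightarrow> q"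
    and "casoratian a v Q \<longlonglongrightarrow> p'" "casoratian a v cQ \<longlonglongrightarrow> q'"
  shows "wronskian a u v * (2 * \<i> * of_real w) = p * q' - q * p'"
proof (rule LIMSEQ_unique)
  show "(\<lambda>n. wronskian a u v * D n) \<longlonglongrightarrow> wronskian a u v * (2 * \<i> * of_real w)"
    by (intro tendsto_intros D_lim)
  have "(\<lambda>n. casoratian a u Q n * casoratian a v cQ n - casoratian a u cQ n * casoratian a v Q n)
      \<longlonglongrightarrow> p * q' - q * p'"
    by (intro tendsto_intros assms)
  then show "(\<lambda>n. wronskian a u v * D n) \<longlonglongrightarrow> p * q' - q * p'"
    using casoratian_pluecker[of a u v _ Q cQ] casoratian_solutions[OF assms(1,2)] by simp
qed

text \<open>Its Wronskian with every solution would vanish, and testing against the two solutions with unit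
initial values makes both initial values of \<open>u\<close> vanish.\<close>

lemma zero_limits_imp_zero:
  assumes u: "jacobi_solution a b x u"
    and "casoratian a u Q \<longlonglongrightarrow> 0" "casoratian a u cQ \<longlonglongrightarrow> 0"
  shows "u = (\<lambda>n. 0)"
proof -
  have "wronskian a u v = 0" if v: "jacobi_solution a b x v" for v
    using casoratians_converge[OF v] wronskian_limits[OF u v assms(2,3)] D_lim_nz by auto
  then have "wronskian a u (jacobi_iterate a b x c d) = 0" for c d
    using jacobi_solution_iterate[of a, OF a_pos] by blast
  from this[of 1 0] this[of 0 1] have "u 0 = 0" "u 1 = 0"
    using a_pos[of 0] by (auto simp: wronskian_def)
  moreover have "jacobi_solution a b x (\<lambda>n. 0)" by (simp add: jacobi_solution_def)
  ultimately show ?thesis using jacobi_solution_eqI[OF a_pos u] by simp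
qed

text \<open>With \<open>p\<close>, \<open>q\<close> the two limits, Cramer's rule reads \<open>u\<^sub>n / Q\<^sub>n = (q - p cnj Q\<^sub>n / Q\<^sub>n) / (2\<i> w) + o(1)\<close>.
Convergence of the left-hand side forces \<open>p = 0\<close>, as otherwise \<open>cnj Q\<^sub>n / Q\<^sub>n\<close> would converge too.\<close>

lemma asymp_iff_limits:
  assumes u: "jacobi_solution a b x u"
  shows "u \<sim>[sequentially] Q \<longleftrightarrow>
    casoratian a u Q \<longlonglongrightarrow> 0 \<and> casoratian a u cQ \<longlonglongrightarrow> 2 * \<i> * of_real w"
proof -
  obtain p q where p: "casoratian a u Q \<longlonglongrightarrow> p" and q: "casoratian a u cQ \<longlonglongrightarrow> q"
    using casoratians_converge[OF u] by blast
  have iff: "u \<sim>[sequentially] Q \<longleftrightarrow> (\<lambda>n. u n / Q n) \<longlonglongrightarrow> 1"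
    unfolding asymp_equiv_def by (rule tendsto_cong) (use Q_nz in eventually_elim, simp)
  have rep: "\<forall>\<^sub>F n in sequentially. u n / Q n =
      (casoratian a u cQ n - casoratian a u Q n * (cQ n / Q n)) / D n"
    using Q_nz D_nz
  proof eventually_elim
    case (elim n)
    then show ?case using casoratian_reconstruct(1)[of u n a Q cQ] by (simp add: field_simps)
  qed
  have bQ: "\<forall>\<^sub>F n in sequentially. norm (cQ n / Q n) \<le> 1"
    by (intro always_eventually allI) (simp add: norm_divide divide_simps)
  show ?thesis
  proof
    assume "u \<sim>[sequentially] Q"
    then have lim: "(\<lambda>n. u n / Q n) \<longlonglongrightarrow> 1" using iff by simp
    have p0: "p = 0"
    proof (rule ccontr)
      assume np: "p \<noteq> 0"
      have "(\<lambda>n. (casoratian a u cQ n - u n / Q n * D n) / casoratian a u Q n)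
          \<longlonglongrightarrow> (q - 1 * (2 * \<i> * of_real w)) / p"
        by (intro tendsto_intros p q lim D_lim np)
      moreover have "\<forall>\<^sub>F n in sequentially. (casoratian a u cQ n - u n / Q n * D n) / casoratian a u Q n
        = cQ n / Q n"
        using rep D_nz tendsto_imp_eventually_ne[OF p np]
        by eventually_elim simp
      ultimately have "(\<lambda>n. cQ n / Q n) \<longlonglongrightarrow> (q - 1 * (2 * \<i> * of_real w)) / p"
        using tendsto_cong by force
      then show False using osc by (auto simp: convergent_def)
    qed
    have "(\<lambda>n. casoratian a u Q n * (cQ n / Q n)) \<longlonglongrightarrow> 0"
      by (rule lim_null_mult_right_bounded[OF _ bQ]) (use p p0 in simp)
    moreover have "(\<lambda>n. u n / Q n * D n) \<longlonglongrightarrow> 1 * (2 * \<i> * of_real w)"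
      by (intro tendsto_intros lim D_lim)
    ultimately have "(\<lambda>n. u n / Q n * D n + casoratian a u Q n * (cQ n / Q n))
       \<longlonglongrightarrow> 1 * (2 * \<i> * of_real w) + 0" by (rule tendsto_add[rotated])
    moreover have "\<forall>\<^sub>F n in sequentially.
        u n / Q n * D n + casoratian a u Q n * (cQ n / Q n) = casoratian a u cQ n"
      using rep D_nz by eventually_elim simp
    ultimately have "casoratian a u cQ \<longlonglongrightarrow> 2 * \<i> * of_real w"
      using tendsto_cong by force
    then show "casoratian a u Q \<longlonglongrightarrow> 0 \<and> casoratian a u cQ \<longlonglongrightarrow> 2 * \<i> * of_real w"
      using p p0 by simp
  next
    assume lims: "casoratian a u Q \<longlonglongrightarrow> 0 \<and> casoratian a u cQ \<longlonglongrightarrow> 2 * \<i> * of_real w"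
    have "(\<lambda>n. casoratian a u Q n * (cQ n / Q n)) \<longlonglongrightarrow> 0"
      by (rule lim_null_mult_right_bounded[OF _ bQ]) (use lims in simp)
    then have "(\<lambda>n. (casoratian a u cQ n - casoratian a u Q n * (cQ n / Q n)) / D n)
        \<longlonglongrightarrow> (2 * \<i> * of_real w - 0) / (2 * \<i> * of_real w)"
      by (intro tendsto_intros D_lim D_lim_nz) (use lims in auto)
    then have "(\<lambda>n. u n / Q n) \<longlonglongrightarrow> 1"
      using tendsto_cong[OF rep] D_lim_nz by simp
    then show "u \<sim>[sequentially] Q" using iff by simp
  qed
qed

text \<open>The pair of limits depends linearly on the solution, and its determinant on a basis is a nonzero
multiple of a Wronskian; hence the pair \<open>0\<close>, \<open>2\<i> w\<close> is attained exactly once.\<close>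

lemma ex1_jost: "\<exists>!F. jacobi_solution a b x F \<and> F \<sim>[sequentially] Q"
proof -
  let ?e = "jacobi_iterate a b x 1 0" and ?g = "jacobi_iterate a b x 0 1"
  have e: "jacobi_solution a b x ?e" and g: "jacobi_solution a b x ?g"
    using jacobi_solution_iterate[of a, OF a_pos] by auto
  obtain p q where p: "casoratian a ?e Q \<longlonglongrightarrow> p" and q: "casoratian a ?e cQ \<longlonglongrightarrow> q"
    using casoratians_converge[OF e] by blast
  obtain p' q' where p': "casoratian a ?g Q \<longlonglongrightarrow> p'" and q': "casoratian a ?g cQ \<longlonglongrightarrow> q'"
    using casoratians_converge[OF g] by blast
  have det: "p * q' - q * p' = of_real (a 0) * (2 * \<i> * of_real w)"
    using wronskian_limits[OF e g p q p' q'] by (simp add: wronskian_def)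
  \<comment> \<open>Coefficients from Cramer's rule for the limits \<open>0\<close> and \<open>2\<i> w\<close>; the determinant is \<open>2\<i> w a\<^sub>0\<close>.\<close>
  define c where "c = - p' / of_real (a 0)"
  define d where "d = p / of_real (a 0)"
  define F where "F = (\<lambda>n. c * ?e n + d * ?g n)"
  have a0: "a 0 \<noteq> 0" using a_pos[of 0] by simp
  have F: "jacobi_solution a b x F" unfolding F_def by (rule jacobi_solution_lincomb[OF e g])
  have "casoratian a F Q \<longlonglongrightarrow> c * p + d * p'"
    unfolding F_def casoratian_lincomb by (intro tendsto_intros p p')
  moreover have "c * p + d * p' = 0" by (simp add: c_def d_def)
  moreover have "casoratian a F cQ \<longlonglongrightarrow> c * q + d * q'"
    unfolding F_def casoratian_lincomb by (intro tendsto_intros q q')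
  moreover have "c * q + d * q' = 2 * \<i> * of_real w"
    using det a0 by (simp add: c_def d_def field_simps)
  ultimately have FQ: "F \<sim>[sequentially] Q" using asymp_iff_limits[OF F] by simp
  have "G = F" if G: "jacobi_solution a b x G" "G \<sim>[sequentially] Q" for G
  proof -
    let ?H = "\<lambda>n. 1 * G n + (- 1) * F n"
    have H: "jacobi_solution a b x ?H" by (rule jacobi_solution_lincomb[OF G(1) F])
    have "casoratian a ?H Q \<longlonglongrightarrow> 1 * 0 + (- 1) * 0" "casoratian a ?H cQ \<longlonglongrightarrow> 1 * (2 * \<i> * of_real w) + (- 1) * (2 * \<i> * of_real w)"
      unfolding casoratian_lincomb
      by (intro tendsto_intros; use asymp_iff_limits[OF F] FQ asymp_iff_limits[OF G(1)] G(2) in simp)+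
    then have "?H = (\<lambda>n. 0)" using zero_limits_imp_zero[OF H] by simp
    then show "G = F" by (simp add: fun_eq_iff)
  qed
  then show ?thesis using F FQ by blast
qed

lemma wronskian_jost_cnj:
  assumes f: "jacobi_solution a b x f" and "f \<sim>[sequentially] Q"
  shows "wronskian a f (\<lambda>n. cnj (f n)) = 2 * \<i> * of_real w"
proof -
  have l: "casoratian a f Q \<longlonglongrightarrow> 0" "casoratian a f cQ \<longlonglongrightarrow> 2 * \<i> * of_real w"
    using asymp_iff_limits[OF f] assms(2) by auto
  have "casoratian a (\<lambda>n. cnj (f n)) Q = (\<lambda>n. cnj (casoratian a f cQ n))"
    "casoratian a (\<lambda>n. cnj (f n)) cQ = (\<lambda>n. cnj (casoratian a f Q n))"
    by (auto simp: casoratian_def fun_eq_iff)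
  then have "casoratian a (\<lambda>n. cnj (f n)) Q \<longlonglongrightarrow> cnj (2 * \<i> * of_real w)"
    "casoratian a (\<lambda>n. cnj (f n)) cQ \<longlonglongrightarrow> cnj 0"
    using tendsto_cnj[OF l(1)] tendsto_cnj[OF l(2)] by simp_all
  from wronskian_limits[OF f jacobi_solution_cnj[OF f] l this]
  have "wronskian a f (\<lambda>n. cnj (f n)) * (2 * \<i> * of_real w) = (2 * \<i> * of_real w) * (2 * \<i> * of_real w)"
    by simp
  then show ?thesis using D_lim_nz by (metis mult_right_cancel)
qed

text \<open>The relation \<open>f \<sim> Q\<close> alone would not allow \<open>f\<close> to be replaced by \<open>Q\<close> inside a difference; that the
Wronskian is a determinant of limits does.\<close>

lemma casoratian_tendsto_wronskian_jost:
  assumes u: "jacobi_solution a b x u"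
    and f: "jacobi_solution a b x f" and "f \<sim>[sequentially] Q"
  shows "casoratian a u Q \<longlonglongrightarrow> wronskian a u f"
proof -
  obtain p q where p: "casoratian a u Q \<longlonglongrightarrow> p" and q: "casoratian a u cQ \<longlonglongrightarrow> q"
    using casoratians_converge[OF u] by blast
  have l: "casoratian a f Q \<longlonglongrightarrow> 0" "casoratian a f cQ \<longlonglongrightarrow> 2 * \<i> * of_real w"
    using asymp_iff_limits[OF f] assms(3) by auto
  have "wronskian a u f * (2 * \<i> * of_real w) = p * (2 * \<i> * of_real w)"
    using wronskian_limits[OF u f p q l] by simp
  then have "wronskian a u f = p" using D_lim_nz by (metis mult_right_cancel)
  then show ?thesis using p by simp
qed

text \<open>For real \<open>u\<close> the two Casoratians are conjugate to each other, and Cramer's rule for \<open>u\<^sub>n\<close> collapses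
to an imaginary part.\<close>

lemma real_solution_limits:
  fixes u :: "nat \<Rightarrow> real"
  assumes u: "jacobi_solution a b x (\<lambda>n. of_real (u n))" and "u 0 \<noteq> 0"
    and f: "jacobi_solution a b x f" "f \<sim>[sequentially] Q"
  shows "wronskian a (\<lambda>n. of_real (u n)) f \<noteq> 0"
    and "(\<lambda>n. u n / norm (Q n) + Im (wronskian a (\<lambda>n. of_real (u n)) f * cnj (sgn (Q n))) / w) \<longlonglongrightarrow> 0"
proof -
  let ?u = "\<lambda>n. of_real (u n) :: complex"
  define \<Omega> where "\<Omega> = wronskian a ?u f"
  have l: "casoratian a ?u Q \<longlonglongrightarrow> \<Omega>"
    unfolding \<Omega>_def by (rule casoratian_tendsto_wronskian_jost[OF u f])
  have c: "casoratian a ?u cQ n = cnj (casoratian a ?u Q n)" for n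
    by (simp add: casoratian_def)
  have c': "casoratian a ?u cQ = (\<lambda>n. cnj (casoratian a ?u Q n))"
    by (rule ext) (rule c)
  show "wronskian a ?u f \<noteq> 0"
  proof
    assume "wronskian a ?u f = 0"
    then have "casoratian a ?u Q \<longlonglongrightarrow> 0" using l by (simp add: \<Omega>_def)
    moreover from tendsto_cnj[OF this] have "casoratian a ?u cQ \<longlonglongrightarrow> 0" unfolding c' by simp
    ultimately have "?u = (\<lambda>n. 0)" using zero_limits_imp_zero[OF u] by blast
    then show False using \<open>u 0 \<noteq> 0\<close> by (metis of_real_eq_0_iff)
  qed
  define d where "d n = Im (D n) / 2" for n
  have dlim: "d \<longlonglongrightarrow> w"
  proof -
    have "(\<lambda>n. Im (D n) / 2) \<longlonglongrightarrow> Im (2 * \<i> * of_real w) / 2" by (intro tendsto_intros D_lim) auto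
    then show ?thesis by (simp add: d_def[abs_def])
  qed
  have rep: "\<forall>\<^sub>F n in sequentially. u n / norm (Q n) = - Im (casoratian a ?u Q n * cnj (sgn (Q n))) / d n"
    using Q_nz D_nz
  proof eventually_elim
    case (elim n)
    have Dd: "D n = 2 * \<i> * of_real (d n)" by (simp add: casoratian_def d_def complex_eq_iff)
    then have dn: "d n \<noteq> 0" using elim by auto
    have "Im (of_real (u n) * D n) = Im (casoratian a ?u cQ n * Q n - casoratian a ?u Q n * cQ n)"
      by (rule arg_cong[OF casoratian_reconstruct(1)[of ?u]])
    then have "2 * u n * d n = - 2 * Im (casoratian a ?u Q n * cQ n)"
      by (simp add: c Dd algebra_simps)
    moreover have "casoratian a ?u Q n * cQ n = of_real (norm (Q n)) * (casoratian a ?u Q n * cnj (sgn (Q n)))"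
      using elim by (simp add: sgn_div_norm scaleR_conv_of_real field_simps)
    then have "Im (casoratian a ?u Q n * cQ n) = norm (Q n) * Im (casoratian a ?u Q n * cnj (sgn (Q n)))"
      by (simp only: times_complex.simps Re_complex_of_real Im_complex_of_real)
    ultimately show ?case using dn elim by (simp add: field_simps)
  qed
  have B: "\<forall>\<^sub>F n in sequentially. norm (cnj (sgn (Q n))) \<le> 1"
    by (intro always_eventually allI) (simp add: norm_sgn)
  have "(\<lambda>n. casoratian a ?u Q n / of_real (d n) - \<Omega> / of_real w) \<longlonglongrightarrow> \<Omega> / of_real w - \<Omega> / of_real w"
    using w_pos by (intro tendsto_intros l dlim) auto
  then have "(\<lambda>n. (casoratian a ?u Q n / of_real (d n) - \<Omega> / of_real w) * cnj (sgn (Q n))) \<longlonglongrightarrow> 0"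
    by (intro lim_null_mult_right_bounded[OF _ B]) simp
  then have "(\<lambda>n. - Im ((casoratian a ?u Q n / of_real (d n) - \<Omega> / of_real w) * cnj (sgn (Q n)))) \<longlonglongrightarrow> - Im 0"
    by (intro tendsto_intros)
  moreover have "\<forall>\<^sub>F n in sequentially. 
     - Im ((casoratian a ?u Q n / of_real (d n) - \<Omega> / of_real w) * cnj (sgn (Q n))) =
     u n / norm (Q n) + Im (\<Omega> * cnj (sgn (Q n))) / w"
    using rep
  proof eventually_elim
    case (elim n)
    have "Im ((casoratian a ?u Q n / of_real (d n) - \<Omega> / of_real w) * cnj (sgn (Q n)))
      = Im ((casoratian a ?u Q n * cnj (sgn (Q n))) / of_real (d n) - (\<Omega> * cnj (sgn (Q n))) / of_real w)"
      by (simp add: left_diff_distrib)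
    also have "\<dots> = Im (casoratian a ?u Q n * cnj (sgn (Q n))) / d n - Im (\<Omega> * cnj (sgn (Q n))) / w"
      by (simp only: Im_divide_of_real minus_complex.simps)
    also have "Im (casoratian a ?u Q n * cnj (sgn (Q n))) / d n = - (u n / norm (Q n))"
      by (simp only: elim minus_divide_left[symmetric] minus_minus)
    finally show ?case by (simp only: minus_diff_eq uminus_add_conv_diff)
  qed
  ultimately show "(\<lambda>n. u n / norm (Q n) + Im (wronskian a ?u f * cnj (sgn (Q n))) / w) \<longlonglongrightarrow> 0"
    using tendsto_cong unfolding \<Omega>_def by force
qed

end

section \<open>The correction polynomial\<close>

abbreviation corr_defect :: "nat \<Rightarrow> real poly \<Rightarrow> real poly" where
  "corr_defect L p \<equiv> p + (\<Sum>k=2..L. smult (cos_coeff2 k) ((p + [:0, 1:]) ^ k))"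

lemma monom_dvd_iff_coeff: "monom (1::real) n dvd p \<longleftrightarrow> (\<forall>j<n. coeff p j = 0)"
  by (rule monom_1_dvd_iff')

text \<open>A difference of powers with exponent at least \<open>2\<close> is the difference of the bases times a cofactor that
is divisible by the variable. Hence the defining map is the identity plus a strictly degree-raising perturbation, which gives
both the uniqueness and the successive determination of the coefficients.\<close>

lemma corr_defect_diff:
  assumes "monom 1 1 dvd p" "monom 1 1 dvd q"
  shows "\<exists>s. corr_defect L p - corr_defect L q = (p - q) * (1 + monom 1 1 * s)"
proof -
  let ?X = "[:0, 1:] :: real poly"
  have X: "?X = monom 1 1" by (simp add: monom_altdef)
  have "\<exists>s. (p + ?X) ^ k - (q + ?X) ^ k = (p - q) * (monom 1 1 * s)" if k: "k \<ge> 2" for k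
  proof -
    have d: "monom 1 1 dvd p + ?X" "monom 1 1 dvd q + ?X" using assms by (auto simp: X)
    have "monom 1 1 dvd (p + ?X) ^ i * (q + ?X) ^ (k - Suc i)" if "i < k" for i
    proof (cases "i = 0")
      case True
      then have "q + ?X dvd (q + ?X) ^ (k - Suc i)" using k by (intro dvd_power) auto
      then show ?thesis using d by (meson dvd_mult dvd_trans)
    next
      case False
      then have "p + ?X dvd (p + ?X) ^ i" by (intro dvd_power) auto
      then show ?thesis using d by (meson dvd_mult2 dvd_trans)
    qed
    then have "monom 1 1 dvd (\<Sum>i<k. (p + ?X) ^ i * (q + ?X) ^ (k - Suc i))"
      by (intro dvd_sum) auto
    then obtain s where "(\<Sum>i<k. (p + ?X) ^ i * (q + ?X) ^ (k - Suc i)) = monom 1 1 * s" by (auto elim: dvdE)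
    moreover have "(p + ?X) ^ k - (q + ?X) ^ k = (p - q) * (\<Sum>i<k. (p + ?X) ^ i * (q + ?X) ^ (k - Suc i))"
      using power_diff_sumr2[of "p + ?X" k "q + ?X"] by (simp add: mult.commute)
    ultimately show ?thesis by auto
  qed
  then obtain s where s: "\<And>k. k \<ge> 2 \<Longrightarrow> (p + ?X) ^ k - (q + ?X) ^ k = (p - q) * (monom 1 1 * s k)"
    by metis
  have "corr_defect L p - corr_defect L q
      = (p - q) + (\<Sum>k=2..L. smult (cos_coeff2 k) ((p + ?X) ^ k - (q + ?X) ^ k))"
    by (simp add: sum_subtractf smult_diff_right)
  also have "\<dots> = (p - q) + (\<Sum>k=2..L. smult (cos_coeff2 k) ((p - q) * (monom 1 1 * s k)))"
    using s by simp
  also have "\<dots> = (p - q) * (1 + monom 1 1 * (\<Sum>k=2..L. smult (cos_coeff2 k) (s k)))"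
    by (simp add: algebra_simps sum_distrib_left)
  finally show ?thesis by blast
qed

lemma is_corr_poly_iff:
  assumes "L \<ge> 1"
  shows "is_corr_poly L p \<longleftrightarrow> degree p \<le> L \<and> monom 1 2 dvd p \<and> monom 1 (Suc L) dvd corr_defect L p"
proof -
  have "monom 1 2 dvd p \<longleftrightarrow> coeff p 0 = 0 \<and> coeff p 1 = 0"
    unfolding monom_dvd_iff_coeff by (auto simp: less_2_cases_iff)
  moreover have "monom 1 (Suc L) dvd q \<longleftrightarrow> (\<forall>j\<le>L. coeff q j = 0)" for q :: "real poly"
    unfolding monom_dvd_iff_coeff by (simp only: less_Suc_eq_le)
  ultimately show ?thesis unfolding is_corr_poly_def by (simp only: conj_assoc)
qed

text \<open>The second factor is a unit among formal power series.\<close>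

lemma monom_dvd_mult_unit_cancel:
  fixes d :: "real poly"
  assumes "monom 1 n dvd d * (1 + monom 1 1 * s)"
  shows "monom 1 n dvd d"
  using assms
proof (induction n)
  case (Suc n)
  have "monom 1 n dvd monom (1::real) (Suc n)" by (auto simp: monom_dvd_iff_coeff)
  then have "monom 1 n dvd d" using Suc by (blast intro: dvd_trans)
  then have "monom 1 1 * monom 1 n dvd (monom 1 1 * s) * d" by (intro mult_dvd_mono dvd_triv_left)
  then have "monom 1 (Suc n) dvd (monom 1 1 * s) * d" by (simp add: mult_monom)
  from dvd_diff[OF Suc.prems this] show ?case by (simp add: algebra_simps)
qed (simp add: monom_dvd_iff_coeff)

lemma corr_poly_unique:
  assumes L: "L \<ge> 1" and p: "is_corr_poly L p" and q: "is_corr_poly L q"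
  shows "p = q"
proof (rule ccontr)
  assume "p \<noteq> q"
  have X: "monom 1 1 dvd r" if "monom 1 2 dvd r" for r :: "real poly"
    using that by (auto simp: monom_dvd_iff_coeff)
  obtain s where s: "corr_defect L p - corr_defect L q = (p - q) * (1 + monom 1 1 * s)"
    using corr_defect_diff[of p q L] X p q unfolding is_corr_poly_iff[OF L] by blast
  have "monom 1 (Suc L) dvd corr_defect L p" "monom 1 (Suc L) dvd corr_defect L q"
    using p q unfolding is_corr_poly_iff[OF L] by blast+
  then have "monom 1 (Suc L) dvd (p - q) * (1 + monom 1 1 * s)"
    unfolding s[symmetric] by (rule dvd_diff)
  then have "monom 1 (Suc L) dvd p - q" by (rule monom_dvd_mult_unit_cancel)
  then have "degree (monom 1 (Suc L) :: real poly) \<le> degree (p - q)"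
    using \<open>p \<noteq> q\<close> by (intro dvd_imp_degree_le) auto
  moreover have "degree (p - q) \<le> L"
    using p q by (intro degree_diff_le) (auto simp: is_corr_poly_def)
  ultimately show False by (simp add: degree_monom_eq)
qed

text \<open>If \<open>G p\<close> starts with \<open>g X\<^sup>M\<^sup>+\<^sup>1\<close>, subtracting this term from \<open>p\<close> removes it from \<open>G p\<close> and disturbs
only higher degrees.\<close>

lemma successive_coefficients:
  fixes G :: "real poly \<Rightarrow> real poly"
  assumes diff: "\<And>p q. monom 1 1 dvd p \<Longrightarrow> monom 1 1 dvd q \<Longrightarrow> \<exists>s. G p - G q = (p - q) * (1 + monom 1 1 * s)"
    and zero: "monom 1 2 dvd G 0" and M: "M \<ge> 1"
  shows "\<exists>p. degree p \<le> M \<and> monom 1 2 dvd p \<and> monom 1 (Suc M) dvd G p"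
  using M
proof (induction M rule: dec_induct)
  case base
  have "monom 1 (Suc 1) dvd G 0" using zero by (simp only: Suc_1)
  then show ?case by (intro exI[of _ 0] conjI) simp_all
next
  case (step M)
  then obtain p where p: "degree p \<le> M" "monom 1 2 dvd p" "monom 1 (Suc M) dvd G p" by blast
  define g where "g = coeff (G p) (Suc M)"
  define q where "q = p - monom g (Suc M)"
  have d2: "monom 1 2 dvd q"
    unfolding q_def using p(2) step.hyps by (auto simp: monom_dvd_iff_coeff)
  have "monom 1 1 dvd q" "monom 1 1 dvd p"
    using d2 p(2) by (auto simp: monom_dvd_iff_coeff)
  from diff[OF this] obtain s where s: "G q - G p = (q - p) * (1 + monom 1 1 * s)" by blast
  have m: "monom g (Suc M) * monom 1 1 = monom g (Suc (Suc M))" by (simp add: mult_monom)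
  have "G q = G p + (q - p) * (1 + monom 1 1 * s)" using s by (simp add: algebra_simps)
  also have "\<dots> = G p - monom g (Suc M) - monom g (Suc M) * monom 1 1 * s"
    by (simp add: q_def algebra_simps)
  finally have eq: "G q = G p - monom g (Suc M) - monom g (Suc (Suc M)) * s" unfolding m .
  have "monom 1 (Suc (Suc M)) dvd G p - monom g (Suc M)"
    using p(3) unfolding monom_dvd_iff_coeff by (auto simp: g_def less_Suc_eq)
  moreover have "monom 1 (Suc (Suc M)) dvd monom g (Suc (Suc M)) * s"
    by (intro dvd_mult2) (auto simp: monom_dvd_iff_coeff)
  ultimately have "monom 1 (Suc (Suc M)) dvd G q" unfolding eq by (rule dvd_diff)
  moreover have "degree q \<le> Suc M"
    unfolding q_def using p(1) by (intro degree_diff_le) (auto simp: degree_monom_le)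
  ultimately show ?case using d2 by blast
qed

lemma corr_poly_exists:
  assumes L: "L \<ge> 1"
  shows "\<exists>p. is_corr_poly L p"
proof -
  have "monom 1 2 dvd [:0, 1::real:] ^ k" if "k \<ge> 2" for k
  proof -
    have "[:0, 1::real:] ^ 2 = monom 1 2" by (simp add: monom_altdef)
    then show ?thesis using le_imp_power_dvd[OF that, of "[:0, 1::real:]"] by (simp only:)
  qed
  then have "monom 1 2 dvd (\<Sum>k=2..L. smult (cos_coeff2 k) ([:0, 1::real:] ^ k))"
    by (intro dvd_sum dvd_smult) simp
  then have "monom 1 2 dvd corr_defect L 0" by (simp only: add_0)
  from successive_coefficients[of "corr_defect L", OF corr_defect_diff this L]
  show ?thesis unfolding is_corr_poly_iff[OF L] by blast
qed

lemma is_corr_poly_corr_poly: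
  assumes "L \<ge> 1" shows "is_corr_poly L (corr_poly L)"
  unfolding corr_poly_def
proof (rule theI', rule ex_ex1I)
  show "\<exists>p. is_corr_poly L p" by (rule corr_poly_exists[OF assms])
  show "p = q" if "is_corr_poly L p" "is_corr_poly L q" for p q
    using that by (rule corr_poly_unique[OF assms])
qed

section \<open>Sequences bounded by powers of the index\<close>

abbreviation O_pow :: "real \<Rightarrow> (nat \<Rightarrow> real) set" where
  "O_pow e \<equiv> O(\<lambda>n. real n powr e)"

lemma O_pow_mono: "f \<in> O_pow d \<Longrightarrow> d \<le> e \<Longrightarrow> f \<in> O_pow e"
proof -
  assume "d \<le> e"
  then have "(\<lambda>n::nat. real n powr d) \<in> O_pow e"
    by (intro bigoI[of _ 1] eventually_mono[OF eventually_ge_at_top[of 1]]) (auto intro: powr_mono)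
  then show "f \<in> O_pow d \<Longrightarrow> f \<in> O_pow e" by (rule landau_o.big_trans[rotated])
qed

lemma O_pow_cong: "f \<in> O_pow e \<Longrightarrow> \<forall>\<^sub>F n in sequentially. f n = g n \<Longrightarrow> g \<in> O_pow e"
  by (simp add: landau_o.big.in_cong)

lemma O_pow_le: "g \<in> O_pow e \<Longrightarrow> \<forall>\<^sub>F n in sequentially. norm (f n) \<le> norm (g n) \<Longrightarrow> f \<in> O_pow e"
  by (rule landau_o.big_trans[OF landau_o.big_mono])

lemma O_pow_mult: "f \<in> O_pow d \<Longrightarrow> g \<in> O_pow e \<Longrightarrow> d + e \<le> k \<Longrightarrow> (\<lambda>n. f n * g n) \<in> O_pow k"
  using O_pow_mono[of _ "d + e" k] landau_o.big.mult[of f sequentially _ g] by (simp add: powr_add)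

lemma O_pow_of_lim:
  assumes "(\<lambda>n. f n * real n powr e) \<longlonglongrightarrow> c" shows "f \<in> O_pow (- e)"
proof (rule bigoI_tendsto)
  show "(\<lambda>n. f n / real n powr (- e)) \<longlonglongrightarrow> c" using assms by (simp add: powr_minus divide_inverse)
  show "\<forall>\<^sub>F n in sequentially. real n powr (- e) \<noteq> 0"
    using eventually_gt_at_top[of 0] by eventually_elim simp
qed

lemma O_pow_inverse_of_lim:
  assumes "(\<lambda>n. f n * real n powr e) \<longlonglongrightarrow> c" "c \<noteq> 0" shows "(\<lambda>n. 1 / f n) \<in> O_pow e"
proof -
  have "(\<lambda>n. inverse (f n) * real n powr (- e)) \<longlonglongrightarrow> inverse c"
    using tendsto_inverse[OF assms] by (simp add: powr_minus)
  from O_pow_of_lim[OF this] show ?thesis by (simp add: field_simps)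
qed

lemma O_pow_const_over: "(\<lambda>n. k / real n) \<in> O_pow (- 1)"
  by (rule bigoI[of _ "\<bar>k\<bar>"]) (auto simp: powr_minus field_simps intro!: always_eventually)

lemma O_pow_Suc: assumes "f \<in> O_pow e" shows "(\<lambda>n. f (Suc n)) \<in> O_pow e"
proof -
  have "(\<lambda>n. f (Suc n)) \<in> O(\<lambda>n. real (Suc n) powr e)"
    using landau_o.big.compose[OF assms filterlim_Suc] .
  moreover have "(\<lambda>n. real (Suc n) powr e) \<in> O_pow e" by real_asymp
  ultimately show ?thesis by (rule landau_o.big_trans)
qed

lemma O_pow_pred: assumes "f \<in> O_pow e" shows "(\<lambda>n. f (n - 1)) \<in> O_pow e"
proof -
  have "filterlim (\<lambda>n::nat. n - 1) sequentially sequentially"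
    by (rule filterlim_minus_const_nat_at_top)
  from landau_o.big.compose[OF assms this] have "(\<lambda>n. f (n - 1)) \<in> O(\<lambda>n. real (n - 1) powr e)" .
  moreover have "(\<lambda>n. real (n - 1) powr e) \<in> O_pow e" by real_asymp
  ultimately show ?thesis by (rule landau_o.big_trans)
qed

lemma O_pow_tendsto_0: assumes "f \<in> O_pow e" "e < 0" shows "f \<longlonglongrightarrow> 0"
proof -
  have "(\<lambda>n::nat. real n powr e) \<longlonglongrightarrow> 0" using assms(2) by real_asymp
  then have lim: "(\<lambda>n. C * real n powr e) \<longlonglongrightarrow> 0" for C by (rule tendsto_mult_right_zero)
  obtain C where "\<forall>\<^sub>F n in sequentially. norm (f n) \<le> C * norm (real n powr e)"
    using assms(1) by (rule landau_o.bigE)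
  then show ?thesis by (intro Lim_null_comparison[OF _ lim[of C]]) simp
qed

lemma one_plus_inverse_powr: "(\<lambda>n. (1 + 1 / real n) powr s - 1 - s / real n) \<in> O_pow (- 2)"
  by real_asymp
lemma one_minus_inverse_powr: "(\<lambda>n. (1 - 1 / real n) powr s - 1 + s / real n) \<in> O_pow (- 2)"
  by real_asymp


lemma O_pow_power: "f \<in> O_pow e \<Longrightarrow> (\<lambda>n. f n ^ k) \<in> O_pow (real k * e)"
proof (induction k)
  case 0
  have "(\<lambda>_. 1) \<in> O_pow 0"
    by (intro bigoI[of _ 1] eventually_mono[OF eventually_ge_at_top[of 1]]) auto
  then show ?case by simp
next
  case (Suc k)
  show ?case using O_pow_mult[OF Suc.prems Suc.IH[OF Suc.prems], of "real (Suc k) * e"]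
    by (simp add: algebra_simps)
qed

lemma bounded_of_O_pow: "f \<in> O_pow e \<Longrightarrow> e \<le> 0 \<Longrightarrow> f \<in> O(\<lambda>_. 1)"
proof -
  assume "f \<in> O_pow e" "e \<le> 0"
  then have "f \<in> O_pow 0" by (rule O_pow_mono)
  moreover have "(\<lambda>n::nat. real n powr 0) \<in> O(\<lambda>_. 1)" by (intro bigoI[of _ 1] always_eventually) auto
  ultimately show ?thesis by (rule landau_o.big_trans)
qed

lemma O_pow_mult_bounded: "f \<in> O_pow e \<Longrightarrow> g \<in> O(\<lambda>_. 1) \<Longrightarrow> (\<lambda>n. f n * g n) \<in> O_pow e"
  using landau_o.big.mult[of f sequentially _ g "\<lambda>_. 1"] by simp

section \<open>Square roots and trigonometric functions of a power law\<close>

lemma eventually_pos_of_lim: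
  assumes "(\<lambda>n. T n * real n powr \<nu>) \<longlonglongrightarrow> c" "c > 0" shows "\<forall>\<^sub>F n in sequentially. T n > (0::real)"
proof -
  have "\<forall>\<^sub>F n in sequentially. T n * real n powr \<nu> > 0" using assms by (rule order_tendstoD)
  then show ?thesis by eventually_elim (metis mult_nonpos_nonneg not_less powr_ge_zero)
qed

lemma sqrt_power_law:
  assumes "(\<lambda>n. T n * real n powr \<nu>) \<longlonglongrightarrow> c"
  shows "(\<lambda>n. sqrt (T n) * real n powr (\<nu> / 2)) \<longlonglongrightarrow> sqrt c"
proof -
  have "sqrt (real n powr \<nu>) = real n powr (\<nu> / 2)" for n
    by (cases "n = 0") (simp_all add: powr_half_sqrt[symmetric] powr_powr)
  then show ?thesis using tendsto_real_sqrt[OF assms] by (simp add: real_sqrt_mult)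
qed

text \<open>Write \<open>d\<^sub>n\<close> for the increment of \<open>\<theta>\<close>. From \<open>T\<^sub>n\<^sub>+\<^sub>1 - T\<^sub>n = d\<^sub>n (2 \<theta>\<^sub>n + d\<^sub>n)\<close> one first gets the size of \<open>d\<^sub>n\<close>;
then \<open>d\<^sub>n\<^sup>2\<close> is a negligible term and division by \<open>2 \<theta>\<^sub>n\<close> transfers the hypothesis from \<open>T\<close> to its square root,
with \<open>\<nu> / 2\<close> in place of \<open>\<nu>\<close>.\<close>

lemma sqrt_increment:
  fixes T :: "nat \<Rightarrow> real"
  assumes T: "(\<lambda>n. T n * real n powr \<nu>) \<longlonglongrightarrow> c" and c: "c > 0" and \<epsilon>: "0 < \<epsilon>" "\<epsilon> \<le> 1"
    and inc: "(\<lambda>n. T (Suc n) - T n + \<nu> / real n * T n) \<in> O_pow (- 1 - \<nu> - \<epsilon>)"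
  defines "\<theta> \<equiv> \<lambda>n. sqrt (T n)"
  shows "(\<lambda>n. \<theta> (Suc n) - \<theta> n) \<in> O_pow (- 1 - \<nu> / 2)"
    and "(\<lambda>n. \<theta> (Suc n) - \<theta> n + \<nu> / (2 * real n) * \<theta> n) \<in> O_pow (- 1 - \<nu> / 2 - \<epsilon>)"
proof -
  define E where "E = (\<lambda>n. T (Suc n) - T n + \<nu> / real n * T n)"
  define d where "d = (\<lambda>n. \<theta> (Suc n) - \<theta> n)"
  have E: "E \<in> O_pow (- 1 - \<nu> - \<epsilon>)" using inc by (simp add: E_def)
  have pos: "\<forall>\<^sub>F n in sequentially. T n > 0" by (rule eventually_pos_of_lim[OF T c])
  then have pos': "\<forall>\<^sub>F n in sequentially. T (Suc n) > 0" by (subst eventually_sequentially_Suc)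
  have \<theta>: "(\<lambda>n. \<theta> n * real n powr (\<nu> / 2)) \<longlonglongrightarrow> sqrt c" unfolding \<theta>_def by (rule sqrt_power_law[OF T])
  have inv\<theta>: "(\<lambda>n. 1 / \<theta> n) \<in> O_pow (\<nu> / 2)" using O_pow_inverse_of_lim[OF \<theta>] c by simp
  have "(\<lambda>n. \<nu> / real n * T n) \<in> O_pow (- 1 - \<nu>)"
    by (rule O_pow_mult[OF O_pow_const_over O_pow_of_lim[OF T]]) simp
  moreover have "E \<in> O_pow (- 1 - \<nu>)" using O_pow_mono[OF E] \<epsilon> by simp
  ultimately have "(\<lambda>n. E n - \<nu> / real n * T n) \<in> O_pow (- 1 - \<nu>)" by (rule sum_in_bigo(2)[rotated])
  then have "(\<lambda>n. (E n - \<nu> / real n * T n) * (1 / \<theta> n)) \<in> O_pow (- 1 - \<nu> / 2)"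
    by (rule O_pow_mult[OF _ inv\<theta>]) (simp add: field_simps)
  moreover have "\<forall>\<^sub>F n in sequentially. norm (d n) \<le> norm ((E n - \<nu> / real n * T n) * (1 / \<theta> n))"
    using pos pos'
  proof eventually_elim
    case (elim n)
    have sq: "\<theta> n > 0" "\<theta> (Suc n) > 0" "T n = \<theta> n ^ 2" "T (Suc n) = \<theta> (Suc n) ^ 2"
      using elim by (simp_all add: \<theta>_def)
    have "E n - \<nu> / real n * T n = d n * (\<theta> (Suc n) + \<theta> n)"
      by (simp add: E_def d_def sq(3,4) algebra_simps power2_eq_square)
    then have "\<bar>(E n - \<nu> / real n * T n) * (1 / \<theta> n)\<bar> = \<bar>d n\<bar> * ((\<theta> (Suc n) + \<theta> n) / \<theta> n)"
      using sq by (simp add: abs_mult)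
    moreover have "\<bar>d n\<bar> * 1 \<le> \<bar>d n\<bar> * ((\<theta> (Suc n) + \<theta> n) / \<theta> n)"
      using sq by (intro mult_left_mono) auto
    ultimately show ?case by simp
  qed
  ultimately have d: "d \<in> O_pow (- 1 - \<nu> / 2)" by (rule O_pow_le)
  then show "(\<lambda>n. \<theta> (Suc n) - \<theta> n) \<in> O_pow (- 1 - \<nu> / 2)" by (simp add: d_def)
  have "(\<lambda>n. d n * d n) \<in> O_pow (- 1 - \<nu> - \<epsilon>)" by (rule O_pow_mult[OF d d]) (use \<epsilon> in simp)
  then have "(\<lambda>n. E n - d n * d n) \<in> O_pow (- 1 - \<nu> - \<epsilon>)" by (rule sum_in_bigo(2)[OF E])
  then have "(\<lambda>n. 1 / 2 * ((E n - d n * d n) * (1 / \<theta> n))) \<in> O_pow (- 1 - \<nu> / 2 - \<epsilon>)"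
    by (intro landau_o.big.cmult_in_iff[THEN iffD2] O_pow_mult[OF _ inv\<theta>]) auto
  moreover have "\<forall>\<^sub>F n in sequentially. 1 / 2 * ((E n - d n * d n) * (1 / \<theta> n)) = d n + \<nu> / (2 * real n) * \<theta> n"
    using pos pos' eventually_gt_at_top[of 0]
  proof eventually_elim
    case (elim n)
    have sq: "\<theta> n > 0" "T n = \<theta> n ^ 2" "T (Suc n) = \<theta> (Suc n) ^ 2" "real n > 0"
      using elim by (simp_all add: \<theta>_def)
    have "E n - d n * d n = 2 * \<theta> n * (d n + \<nu> / (2 * real n) * \<theta> n)"
      using sq(4) by (simp add: E_def d_def sq(2,3) field_simps power2_eq_square)
    then show ?case using sq(1) by simp
  qed
  ultimately show "(\<lambda>n. \<theta> (Suc n) - \<theta> n + \<nu> / (2 * real n) * \<theta> n) \<in> O_pow (- 1 - \<nu> / 2 - \<epsilon>)"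
    unfolding d_def by (rule O_pow_cong)
qed

lemma abs_one_minus_cos_le: "\<bar>cos x - 1\<bar> \<le> (x::real)\<^sup>2"
proof -
  have "cos x = 1 - 2 * sin (x / 2) ^ 2" using cos_double_sin[of "x / 2"] by simp
  moreover have "sin (x / 2) ^ 2 \<le> (x / 2) ^ 2" using abs_sin_x_le_abs_x[of "x / 2"] abs_le_square_iff by blast
  moreover have "(x / 2) ^ 2 = x ^ 2 / 4" by (simp add: power_divide)
  ultimately show ?thesis using zero_le_power2[of "sin (x / 2)"] zero_le_power2[of x] by linarith
qed

lemma abs_cos_diff_le: "\<bar>cos x - cos (y::real)\<bar> \<le> \<bar>x - y\<bar> * (\<bar>x\<bar> + \<bar>y\<bar>)"
proof -
  have "\<bar>cos x - cos y\<bar> = 2 * \<bar>sin ((x + y) / 2)\<bar> * \<bar>sin ((y - x) / 2)\<bar>"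
    by (simp add: cos_diff_cos abs_mult)
  also have "\<dots> \<le> 2 * \<bar>(x + y) / 2\<bar> * \<bar>(y - x) / 2\<bar>"
    by (intro mult_mono abs_sin_x_le_abs_x mult_left_mono) auto
  also have "\<dots> = \<bar>x - y\<bar> * \<bar>x + y\<bar> / 2" by (simp add: abs_minus_commute)
  also have "\<dots> \<le> \<bar>x - y\<bar> * \<bar>x + y\<bar>" by simp
  also have "\<dots> \<le> \<bar>x - y\<bar> * (\<bar>x\<bar> + \<bar>y\<bar>)" by (intro mult_left_mono abs_triangle_ineq) simp
  finally show ?thesis .
qed

text \<open>Mean value inequality for \<open>sin t - t\<close>, whose derivative is quadratically small.\<close>

lemma abs_sin_diff_minus_diff_le:
  "\<bar>(sin x - sin y) - (x - y)\<bar> \<le> \<bar>x - y\<bar> * (\<bar>x\<bar> + \<bar>y\<bar> :: real)\<^sup>2"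
proof -
  have "norm ((sin x - x) - (sin y - y)) \<le> (\<bar>x\<bar> + \<bar>y\<bar>)\<^sup>2 * norm (x - y)"
  proof (rule field_differentiable_bound[where S = "closed_segment x y" and f' = "\<lambda>t. cos t - 1"])
    show "((\<lambda>t. sin t - t) has_field_derivative cos t - 1) (at t within closed_segment x y)" for t
      by (auto intro!: derivative_eq_intros)
    show "norm (cos t - 1) \<le> (\<bar>x\<bar> + \<bar>y\<bar>)\<^sup>2" if "t \<in> closed_segment x y" for t
    proof -
      have "\<bar>t\<bar> \<le> \<bar>x\<bar> + \<bar>y\<bar>" using that by (auto simp: closed_segment_eq_real_ivl split: if_splits)
      then have "t\<^sup>2 \<le> (\<bar>x\<bar> + \<bar>y\<bar>)\<^sup>2" by (metis abs_ge_zero power2_abs power_mono)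
      then show ?thesis using abs_one_minus_cos_le[of t] by simp
    qed
  qed auto
  then show ?thesis by (simp add: algebra_simps)
qed

text \<open>Replacing \<open>\<theta>\<close> by \<open>sin \<theta>\<close> changes both \<open>\<theta>\<close> and its increments by a relative error of order \<open>\<theta>\<^sup>2\<close>,
that is, \<open>n powr (-\<nu>)\<close>.\<close>

lemma trig_increments:
  fixes \<theta> :: "nat \<Rightarrow> real"
  assumes \<nu>: "0 < \<nu>" and \<epsilon>: "0 \<le> \<epsilon>" "\<epsilon> \<le> \<nu>"
    and \<theta>: "\<theta> \<in> O_pow (- \<nu> / 2)"
    and d: "(\<lambda>n. \<theta> (Suc n) - \<theta> n) \<in> O_pow (- 1 - \<nu> / 2)"
    and inc: "(\<lambda>n. \<theta> (Suc n) - \<theta> n + \<nu> / (2 * real n) * \<theta> n) \<in> O_pow (- 1 - \<nu> / 2 - \<epsilon>)"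
  shows "(\<lambda>n. cos (\<theta> (Suc n)) - cos (\<theta> n)) \<in> O_pow (- 1 - \<nu>)"
    and "(\<lambda>n. sin (\<theta> (Suc n)) - sin (\<theta> n)) \<in> O_pow (- 1 - \<nu> / 2)"
    and "(\<lambda>n. sin (\<theta> (Suc n)) - sin (\<theta> n) + \<nu> / (2 * real n) * sin (\<theta> n)) \<in> O_pow (- 1 - \<nu> / 2 - \<epsilon>)"
proof -
  define s where "s = (\<lambda>n. \<bar>\<theta> (Suc n)\<bar> + \<bar>\<theta> n\<bar>)"
  have s: "s \<in> O_pow (- \<nu> / 2)"
    unfolding s_def using O_pow_Suc[OF \<theta>] \<theta> by (intro sum_in_bigo(1)) auto
  have ds: "(\<lambda>n. (\<theta> (Suc n) - \<theta> n) * s n) \<in> O_pow (- 1 - \<nu>)"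
    by (rule O_pow_mult[OF d s]) (simp add: field_simps)
  show "(\<lambda>n. cos (\<theta> (Suc n)) - cos (\<theta> n)) \<in> O_pow (- 1 - \<nu>)"
    by (rule landau_o.big_trans[OF landau_o.big_mono ds], rule always_eventually)
       (use abs_cos_diff_le in \<open>auto simp: s_def abs_mult\<close>)
  have dss: "(\<lambda>n. (\<theta> (Suc n) - \<theta> n) * s n * s n) \<in> O_pow (- 1 - \<nu> / 2 - \<epsilon>)"
    by (rule O_pow_mult[OF ds s]) (use \<nu> \<epsilon> in \<open>simp add: field_simps\<close>)
  have rem: "(\<lambda>n. (sin (\<theta> (Suc n)) - sin (\<theta> n)) - (\<theta> (Suc n) - \<theta> n)) \<in> O_pow (- 1 - \<nu> / 2 - \<epsilon>)"
    by (rule landau_o.big_trans[OF landau_o.big_mono dss], rule always_eventually)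
       (use abs_sin_diff_minus_diff_le in \<open>auto simp: s_def abs_mult power2_eq_square mult.assoc\<close>)
  have "\<bar>sin t - t\<bar> \<le> \<bar>t * t * t\<bar>" for t :: real
    using abs_sin_diff_minus_diff_le[of t 0] by (simp add: abs_mult power2_eq_square mult.assoc)
  then have "(\<lambda>n. sin (\<theta> n) - \<theta> n) \<in> O(\<lambda>n. \<theta> n * \<theta> n * \<theta> n)"
    by (intro landau_o.big_mono always_eventually) auto
  moreover have "(\<lambda>n. \<theta> n * \<theta> n * \<theta> n) \<in> O_pow (- 3 * \<nu> / 2)"
    by (rule O_pow_mult[OF O_pow_mult[OF \<theta> \<theta> order_refl] \<theta>]) simp
  ultimately have "(\<lambda>n. sin (\<theta> n) - \<theta> n) \<in> O_pow (- 3 * \<nu> / 2)" by (rule landau_o.big_trans)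
  then have rem2: "(\<lambda>n. (\<nu> / 2) / real n * (sin (\<theta> n) - \<theta> n)) \<in> O_pow (- 1 - \<nu> / 2 - \<epsilon>)"
    by (rule O_pow_mult[OF O_pow_const_over]) (use \<epsilon> in \<open>simp add: field_simps\<close>)
  show "(\<lambda>n. sin (\<theta> (Suc n)) - sin (\<theta> n) + \<nu> / (2 * real n) * sin (\<theta> n)) \<in> O_pow (- 1 - \<nu> / 2 - \<epsilon>)"
    by (rule O_pow_cong[OF sum_in_bigo(1)[OF sum_in_bigo(1)[OF rem inc] rem2]])
       (simp add: right_diff_distrib diff_divide_distrib)
  show "(\<lambda>n. sin (\<theta> (Suc n)) - sin (\<theta> n)) \<in> O_pow (- 1 - \<nu> / 2)"
    using sum_in_bigo(1)[OF O_pow_mono[OF rem] d] \<epsilon> by simp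
qed

section \<open>Divergence of the phase\<close>

text \<open>Starting from any late point, the first time at which \<open>\<psi>\<close> has grown by \<open>pi\<close> finds \<open>cis \<psi>\<close> almost at the
antipode, because a single step is too short to jump over it.\<close>

lemma not_convergent_cis:
  fixes \<psi> :: "nat \<Rightarrow> real"
  assumes top: "filterlim \<psi> at_top sequentially" and inc: "(\<lambda>n. \<psi> (Suc n) - \<psi> n) \<longlonglongrightarrow> 0"
  shows "\<not> convergent (\<lambda>n. cis (\<psi> n))"
proof
  assume "convergent (\<lambda>n. cis (\<psi> n))"
  then have "Cauchy (\<lambda>n. cis (\<psi> n))" by (simp add: Cauchy_convergent_iff)
  then obtain M1 where M1: "\<And>m n. m \<ge> M1 \<Longrightarrow> n \<ge> M1 \<Longrightarrow> dist (cis (\<psi> m)) (cis (\<psi> n)) < 1"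
    unfolding Cauchy_def by (meson zero_less_one)
  have "\<forall>\<^sub>F n in sequentially. \<psi> (Suc n) - \<psi> n < 1" using inc by (rule order_tendstoD) simp
  then obtain M2 where M2: "\<And>n. n \<ge> M2 \<Longrightarrow> \<psi> (Suc n) - \<psi> n < 1" by (auto simp: eventually_sequentially)
  define M where "M = max M1 M2"
  define m where "m = (LEAST m. m \<ge> M \<and> \<psi> m \<ge> \<psi> M + pi)"
  have "\<forall>\<^sub>F n in sequentially. n \<ge> M \<and> \<psi> n \<ge> \<psi> M + pi"
    using top by (intro eventually_conj eventually_ge_at_top) (simp add: filterlim_at_top)
  then have "\<exists>m. m \<ge> M \<and> \<psi> m \<ge> \<psi> M + pi" by (auto simp: eventually_sequentially)
  then have m: "m \<ge> M" "\<psi> m \<ge> \<psi> M + pi" unfolding m_def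
    using LeastI_ex[of "\<lambda>m. m \<ge> M \<and> \<psi> m \<ge> \<psi> M + pi"] by auto
  then have "m \<noteq> M" using pi_gt_zero by fastforce
  then obtain k where k: "m = Suc k" "k \<ge> M" using m(1) by (cases m) auto
  then have "\<not> (k \<ge> M \<and> \<psi> k \<ge> \<psi> M + pi)" unfolding m_def by (intro not_less_Least) simp
  then have up: "\<psi> m < \<psi> M + pi + 1" using k M2[of k] by (simp add: M_def)
  \<comment> \<open>The overshoot beyond \<open>pi\<close>; it stays below \<open>1 < pi / 2\<close>.\<close>
  define \<delta> where "\<delta> = \<psi> m - \<psi> M - pi"
  have "0 \<le> \<delta>" "\<delta> < 1" using m up by (auto simp: \<delta>_def)
  then have "cos \<delta> > 0" using pi_gt3 by (intro cos_gt_zero_pi) auto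
  moreover have "cos (\<psi> m - \<psi> M) = - cos \<delta>" 
    unfolding \<delta>_def by (simp add: cos_diff)
  ultimately have "1 < \<bar>Re (cis (\<psi> m - \<psi> M) - 1)\<bar>" by simp
  also have "\<dots> \<le> norm (cis (\<psi> m - \<psi> M) - 1)" by (rule abs_Re_le_cmod)
  also have "\<dots> = norm (cis (\<psi> M) * (cis (\<psi> m - \<psi> M) - 1))" by (simp add: norm_mult)
  also have "\<dots> = dist (cis (\<psi> m)) (cis (\<psi> M))" by (simp add: dist_norm algebra_simps cis_mult)
  finally show False using M1[of m M] m(1) by (simp add: M_def)
qed

text \<open>Comparison with the harmonic series; this is where an exponent \<open>\<mu>\<close> above \<open>1\<close> would fail.\<close>

lemma filterlim_sum_power_law_at_top:
  fixes \<theta> :: "nat \<Rightarrow> real"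
  assumes lim: "(\<lambda>n. \<theta> n * real n powr \<mu>) \<longlonglongrightarrow> c" and c: "c > 0" and \<mu>: "\<mu> \<le> 1"
    and nonneg: "\<And>n. n \<ge> N \<Longrightarrow> \<theta> n \<ge> 0"
  shows "filterlim (\<lambda>n. \<Sum>m=N..n. \<theta> m) at_top sequentially"
proof -
  define \<theta>' where "\<theta>' n = (if n \<ge> N then \<theta> n else 0)" for n
  have "\<forall>\<^sub>F n in sequentially. \<theta> n * real n powr \<mu> > c / 2" using lim c by (intro order_tendstoD) auto
  then have ev: "\<forall>\<^sub>F n in sequentially. norm (inverse (real n)) \<le> \<theta>' n * (2 / c)"
    using eventually_ge_at_top[of N] eventually_ge_at_top[of 1]
  proof eventually_elim
    case (elim n)
    have "real n powr \<mu> \<le> real n" using elim \<mu> powr_mono[of \<mu> 1 "real n"] by simp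
    then have "\<theta> n * real n powr \<mu> \<le> \<theta> n * real n" using nonneg[OF elim(2)] by (rule mult_left_mono)
    then have "c / 2 < \<theta> n * real n" using elim by simp
    then show ?case using elim c by (simp add: \<theta>'_def field_simps)
  qed
  have ns: "\<not> summable \<theta>'"
  proof
    assume "summable \<theta>'"
    then have "summable (\<lambda>n. \<theta>' n * (2 / c))" by (rule summable_mult2)
    from summable_comparison_test_ev[OF ev this] show False using not_summable_harmonic[where ?'a = real] by simp
  qed
  have nn: "\<theta>' n \<ge> 0" for n using nonneg by (simp add: \<theta>'_def)
  have eq: "(\<Sum>m=N..n. \<theta> m) = (\<Sum>m<Suc n. \<theta>' m)" for n
    by (rule sum.mono_neutral_cong_left) (auto simp: \<theta>'_def)
  show ?thesis unfolding filterlim_at_top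
  proof
    fix Z
    obtain k where k: "(\<Sum>m<k. \<theta>' m) > Z"
      using summableI_nonneg_bounded[of \<theta>' Z] nn ns by (meson not_le)
    show "\<forall>\<^sub>F n in sequentially. Z \<le> (\<Sum>m=N..n. \<theta> m)"
      using eventually_ge_at_top[of k]
    proof eventually_elim
      case (elim n)
      have "(\<Sum>m<k. \<theta>' m) \<le> (\<Sum>m<Suc n. \<theta>' m)" using elim nn by (intro sum_mono2) auto
      then show ?case using k unfolding eq by simp
    qed
  qed
qed

section \<open>The corrected squared frequency\<close>

lemma poly_bigo_1:
  assumes "f \<in> O(\<lambda>_. 1 :: real)" shows "(\<lambda>n::nat. poly r (f n)) \<in> O(\<lambda>_. 1)"
proof (induction r)
  case (pCons a r)
  have "(\<lambda>n. f n * poly r (f n)) \<in> O(\<lambda>_. 1)"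
    using landau_o.big.mult[OF assms pCons.IH] by simp
  then show ?case by (simp add: sum_in_bigo)
qed simp

text \<open>A polynomial is Lipschitz on bounded sets; the induction over the coefficients avoids naming the
bounded set.\<close>

lemma poly_diff_bigo:
  assumes f: "f \<in> O(\<lambda>_. 1 :: real)" and g: "g \<in> O(\<lambda>_. 1)"
  shows "(\<lambda>n::nat. poly r (f n) - poly r (g n)) \<in> O(\<lambda>n. f n - g n)"
proof (induction r)
  case (pCons a r)
  have "(\<lambda>n. (f n - g n) * poly r (f n)) \<in> O(\<lambda>n. f n - g n)"
    using landau_o.big.mult[OF landau_o.big_refl poly_bigo_1[OF f]] by simp
  moreover have "(\<lambda>n. g n * (poly r (f n) - poly r (g n))) \<in> O(\<lambda>n. f n - g n)"
    using landau_o.big.mult[OF g pCons.IH] by simp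
  ultimately have "(\<lambda>n. (f n - g n) * poly r (f n) + g n * (poly r (f n) - poly r (g n))) \<in> O(\<lambda>n. f n - g n)"
    by (rule sum_in_bigo)
  then show ?case by (simp add: algebra_simps)
qed simp

text \<open>The numbers \<open>cos_coeff2\<close> are the Taylor coefficients of \<open>2 - 2 cos x\<close> as a function of the square of \<open>x\<close>.\<close>

lemma cos_taylor_sum:
  "2 * (\<Sum>m<2 * Suc L. cos_coeff m * x ^ m) = 2 - (\<Sum>k=1..L. cos_coeff2 k * (x\<^sup>2) ^ k)"
proof (induction L)
  case 0
  show ?case by (simp add: cos_coeff_def numeral_2_eq_2)
next
  case (Suc L)
  have "(\<Sum>m<2 * Suc (Suc L). cos_coeff m * x ^ m)
      = (\<Sum>m<2 * Suc L. cos_coeff m * x ^ m) + cos_coeff (2 * Suc L) * x ^ (2 * Suc L)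
        + cos_coeff (Suc (2 * Suc L)) * x ^ Suc (2 * Suc L)"
  proof -
    have "2 * Suc (Suc L) = Suc (Suc (2 * Suc L))" by simp
    then show ?thesis by (simp only: sum.lessThan_Suc)
  qed
  moreover have "cos_coeff (Suc (2 * Suc L)) = 0" by (simp add: cos_coeff_def)
  moreover have "2 * cos_coeff (2 * Suc L) = - cos_coeff2 (Suc L)"
    by (simp add: cos_coeff_def cos_coeff2_def del: fact_Suc)
  then have "2 * (cos_coeff (2 * Suc L) * x ^ (2 * Suc L)) = - cos_coeff2 (Suc L) * (x\<^sup>2) ^ Suc L"
    by (simp only: power_mult mult.assoc[symmetric])
  moreover have "(\<Sum>k=1..Suc L. cos_coeff2 k * (x\<^sup>2) ^ k) = (\<Sum>k=1..L. cos_coeff2 k * (x\<^sup>2) ^ k) + cos_coeff2 (Suc L) * (x\<^sup>2) ^ Suc L"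
    by simp
  ultimately show ?case using Suc.IH by (simp only: distrib_left)
qed

lemma two_cos_sqrt_expansion:
  assumes "y \<ge> 0"
  shows "\<bar>2 * cos (sqrt y) - 2 + (\<Sum>k=1..L. cos_coeff2 k * y ^ k)\<bar> \<le> 2 * y ^ Suc L"
proof -
  obtain s where s: "cos (sqrt y) = (\<Sum>m<2 * Suc L. cos_coeff m * sqrt y ^ m)
      + (cos (s + 1/2 * real (2 * Suc L) * pi) / fact (2 * Suc L)) * sqrt y ^ (2 * Suc L)"
    using Maclaurin_cos_expansion[of "sqrt y" "2 * Suc L"] by blast
  define r where "r = cos (s + 1/2 * real (2 * Suc L) * pi) / fact (2 * Suc L)"
  have "\<bar>r\<bar> \<le> 1"
    unfolding r_def abs_divide by (rule order_trans[OF divide_right_mono[OF abs_cos_le_one]])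
      (use fact_ge_1[of "2 * Suc L", where 'a = real] in \<open>auto simp: field_simps simp del: fact_Suc\<close>)
  have "sqrt y ^ (2 * Suc L) = y ^ Suc L" using assms by (simp only: power_mult real_sqrt_pow2)
  then have "2 * cos (sqrt y) - 2 + (\<Sum>k=1..L. cos_coeff2 k * y ^ k) = 2 * (r * y ^ Suc L)"
    using s cos_taylor_sum[where L = L and x = "sqrt y"] assms unfolding r_def[symmetric] by simp
  also have "\<bar>\<dots>\<bar> = 2 * (\<bar>r\<bar> * y ^ Suc L)" using assms by (simp add: abs_mult)
  also have "\<dots> \<le> 2 * (1 * y ^ Suc L)"
    using \<open>\<bar>r\<bar> \<le> 1\<close> assms by (intro mult_left_mono mult_right_mono) auto
  finally show ?thesis by simp
qed

text \<open>This is the reason for the correction polynomial: with \<open>T = t + P t\<close> the Taylor polynomial of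
\<open>2 - 2 cos (sqrt T)\<close> equals \<open>t\<close> up to terms of degree above \<open>L\<close> in \<open>t\<close>, so that the corrected frequency solves
\<open>2 - 2 cos \<theta> = t\<close> to this order.\<close>

lemma corr_poly_cos_residual:
  fixes t :: "nat \<Rightarrow> real"
  assumes L: "L \<ge> 1" and p: "is_corr_poly L p" and \<nu>: "0 \<le> \<nu>" and t: "t \<in> O_pow (- \<nu>)"
    and pos: "\<forall>\<^sub>F n in sequentially. t n + poly p (t n) \<ge> 0"
  shows "(\<lambda>n. 2 * cos (sqrt (t n + poly p (t n))) - 2 + t n) \<in> O_pow (- (real L + 1) * \<nu>)"
proof -
  define T where "T n = t n + poly p (t n)" for n
  have t1: "t \<in> O(\<lambda>_. 1)" using bounded_of_O_pow[OF t] \<nu> by simp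
  have "[:0, 1:] ^ 2 dvd p" using p L by (simp add: is_corr_poly_iff monom_altdef)
  then obtain q where q: "p = [:0, 1:] ^ 2 * q" by (rule dvdE)
  have "(\<lambda>n. t n * (1 + t n * poly q (t n))) \<in> O_pow (- \<nu>)"
    using landau_o.big.mult[OF t1 poly_bigo_1[OF t1, of q]]
    by (intro O_pow_mult_bounded[OF t] sum_in_bigo) auto
  moreover have "(\<lambda>n. t n * (1 + t n * poly q (t n))) = T"
    by (simp add: T_def q fun_eq_iff algebra_simps power2_eq_square)
  ultimately have T: "T \<in> O_pow (- \<nu>)" by simp
  have "(\<lambda>n. 2 * T n ^ Suc L) \<in> O_pow (real (Suc L) * - \<nu>)"
    by (rule landau_o.big.cmult_in_iff[THEN iffD2, OF _ O_pow_power[OF T]]) simp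
  moreover have "\<forall>\<^sub>F n in sequentially. norm (2 * cos (sqrt (T n)) - 2 + (\<Sum>k=1..L. cos_coeff2 k * T n ^ k)) \<le> norm (2 * T n ^ Suc L)"
    using pos
  proof eventually_elim
    case (elim n)
    then have "T n \<ge> 0" by (simp add: T_def)
    from two_cos_sqrt_expansion[OF this, of L] show ?case by (simp only: real_norm_def) 
  qed
  ultimately have A: "(\<lambda>n. 2 * cos (sqrt (T n)) - 2 + (\<Sum>k=1..L. cos_coeff2 k * T n ^ k)) \<in> O_pow (- (real L + 1) * \<nu>)"
    using O_pow_le[of "\<lambda>n. 2 * T n ^ Suc L" "real (Suc L) * - \<nu>"] by (simp add: algebra_simps)
  have "[:0, 1:] ^ Suc L dvd corr_defect L p" using p L by (simp add: is_corr_poly_iff monom_altdef)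
  then obtain s where s: "corr_defect L p = [:0, 1:] ^ Suc L * s" by (rule dvdE)
  have sum: "(\<Sum>k=1..L. cos_coeff2 k * T n ^ k) = t n + t n ^ Suc L * poly s (t n)" for n
  proof -
    have "(\<Sum>k=1..L. cos_coeff2 k * T n ^ k) = T n + (\<Sum>k=2..L. cos_coeff2 k * T n ^ k)"
      using L by (subst sum.atLeast_Suc_atMost) (auto simp: cos_coeff2_def numeral_2_eq_2)
    also have "\<dots> = t n + poly (corr_defect L p) (t n)"
      by (simp add: T_def poly_sum add.commute)
    also have "\<dots> = t n + t n ^ Suc L * poly s (t n)" by (simp add: s)
    finally show ?thesis .
  qed
  have B: "(\<lambda>n. t n ^ Suc L * poly s (t n)) \<in> O_pow (- (real L + 1) * \<nu>)"
    using O_pow_mult_bounded[OF O_pow_power[OF t, of "Suc L"] poly_bigo_1[OF t1, of s]] by (simp add: algebra_simps)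
  show ?thesis
    by (rule O_pow_cong[OF sum_in_bigo(2)[OF A B]]) (simp only: sum T_def[symmetric], simp)
qed

text \<open>A correction without terms of degree below \<open>2\<close> is smaller than \<open>t\<close> by a full factor of order \<open>t\<close>, and
so is its effect on the increments.\<close>

lemma corrected_power_law:
  fixes t :: "nat \<Rightarrow> real"
  assumes \<nu>: "0 < \<nu>" and \<epsilon>: "\<epsilon> \<le> \<nu>" and p: "monom 1 2 dvd p"
    and t: "(\<lambda>n. t n * real n powr \<nu>) \<longlonglongrightarrow> c"
    and inc: "(\<lambda>n. t (Suc n) - t n + \<nu> / real n * t n) \<in> O_pow (- 1 - \<nu> - \<epsilon>)" "0 < \<epsilon>"
  defines "T \<equiv> \<lambda>n. t n + poly p (t n)"
  shows "(\<lambda>n. T n * real n powr \<nu>) \<longlonglongrightarrow> c"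
    and "(\<lambda>n. T (Suc n) - T n + \<nu> / real n * T n) \<in> O_pow (- 1 - \<nu> - \<epsilon>)"
proof -
  have tO: "t \<in> O_pow (- \<nu>)" by (rule O_pow_of_lim[OF t])
  have t1: "t \<in> O(\<lambda>_. 1)" using bounded_of_O_pow[OF tO] \<nu> by simp
  have "[:0, 1:] ^ 2 dvd p" using p by (simp add: monom_altdef)
  then obtain r where r: "p = [:0, 1:] ^ 2 * r" by (rule dvdE)
  define q where "q = [:0, 1:] * r"
  have pq: "poly p y = y * poly q y" for y by (simp add: r q_def power2_eq_square)
  have qO: "(\<lambda>n. poly q (t n)) \<in> O_pow (- \<nu>)"
    using O_pow_mult_bounded[OF tO poly_bigo_1[OF t1, of r]] by (simp add: q_def)
  have "(\<lambda>n. poly q (t n)) \<longlonglongrightarrow> 0" using O_pow_tendsto_0[OF qO] \<nu> by simp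
  then have "(\<lambda>n. t n * real n powr \<nu> * (1 + poly q (t n))) \<longlonglongrightarrow> c * (1 + 0)"
    by (intro tendsto_intros t)
  then show "(\<lambda>n. T n * real n powr \<nu>) \<longlonglongrightarrow> c" by (simp add: T_def pq algebra_simps)
  have "(\<lambda>n. \<nu> / real n * t n) \<in> O_pow (- 1 - \<nu>)" by (rule O_pow_mult[OF O_pow_const_over tO]) simp
  from sum_in_bigo(2)[OF O_pow_mono[OF inc(1), of "- 1 - \<nu>"] this]
  have d: "(\<lambda>n. t (Suc n) - t n) \<in> O_pow (- 1 - \<nu>)" using inc(2) by simp
  have t1': "(\<lambda>n. t (Suc n)) \<in> O(\<lambda>_. 1)" using bounded_of_O_pow[OF O_pow_Suc[OF tO]] \<nu> by simp
  have dq: "(\<lambda>n. poly q (t (Suc n)) - poly q (t n)) \<in> O_pow (- 1 - \<nu>)"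
    by (rule landau_o.big_trans[OF poly_diff_bigo[OF t1' t1] d])
  have 1: "(\<lambda>n. (t (Suc n) - t n) * poly q (t (Suc n))) \<in> O_pow (- 1 - \<nu> - \<epsilon>)"
    by (rule O_pow_mult[OF d O_pow_Suc[OF qO]]) (use \<epsilon> in simp)
  have 2: "(\<lambda>n. t n * (poly q (t (Suc n)) - poly q (t n))) \<in> O_pow (- 1 - \<nu> - \<epsilon>)"
    by (rule O_pow_mult[OF tO dq]) (use \<epsilon> in simp)
  have 3: "(\<lambda>n. \<nu> / real n * (t n * poly q (t n))) \<in> O_pow (- 1 - \<nu> - \<epsilon>)"
    by (rule O_pow_mult[OF O_pow_const_over O_pow_mult[OF tO qO order_refl]]) (use \<epsilon> in simp)
  show "(\<lambda>n. T (Suc n) - T n + \<nu> / real n * T n) \<in> O_pow (- 1 - \<nu> - \<epsilon>)"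
    using sum_in_bigo(1)[OF sum_in_bigo(1)[OF sum_in_bigo(1)[OF inc(1) 1] 2] 3]
    by (simp add: T_def pq algebra_simps)
qed

lemma small_t_power_law:
  assumes \<sigma>: "\<sigma> > 0" and cases: "(1 < \<sigma> \<and> \<tau> < 0) \<or> (\<sigma> < 1 \<and> z > 0) \<or> (\<sigma> = 1 \<and> z > \<tau>)"
  shows "\<exists>c>0. (\<lambda>n. small_t \<sigma> \<tau> n z * real n powr min \<sigma> 1) \<longlonglongrightarrow> c"
proof -
  have lim: "(\<lambda>n::nat. real n powr e) \<longlonglongrightarrow> 0" if "e < 0" for e using that by real_asymp
  have eq: "\<forall>\<^sub>F n in sequentially. small_t \<sigma> \<tau> n z * real n powr \<nu> = - \<tau> * real n powr (\<nu> - 1) + z * real n powr (\<nu> - \<sigma>)" for \<nu>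
    using eventually_gt_at_top[of 0]
    by eventually_elim (simp add: small_t_def powr_diff powr_minus divide_inverse algebra_simps)
  have one: "\<forall>\<^sub>F n in sequentially. real n powr 0 = 1" using eventually_gt_at_top[of 0] by eventually_elim simp
  then have lim0: "(\<lambda>n::nat. real n powr 0) \<longlonglongrightarrow> 1" by (rule tendsto_eventually)
  consider "1 < \<sigma>" "\<tau> < 0" | "\<sigma> < 1" "z > 0" | "\<sigma> = 1" "z > \<tau>" using cases by blast
  then show ?thesis
  proof cases
    case 1
    have "(\<lambda>n. - \<tau> * real n powr (1 - 1) + z * real n powr (1 - \<sigma>)) \<longlonglongrightarrow> - \<tau> * 1 + z * 0"
      using tendsto_add[OF tendsto_mult_left[OF lim0, of "- \<tau>"] tendsto_mult_left[OF lim[of "1 - \<sigma>"], of z]] 1 by simp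
    then have "(\<lambda>n. small_t \<sigma> \<tau> n z * real n powr 1) \<longlonglongrightarrow> - \<tau>" using tendsto_cong[OF eq[of 1]] by simp
    then show ?thesis using 1 by (intro exI[of _ "- \<tau>"]) (auto simp: min_def)
  next
    case 2
    have "(\<lambda>n. - \<tau> * real n powr (\<sigma> - 1) + z * real n powr (\<sigma> - \<sigma>)) \<longlonglongrightarrow> - \<tau> * 0 + z * 1"
      using tendsto_add[OF tendsto_mult_left[OF lim[of "\<sigma> - 1"], of "- \<tau>"] tendsto_mult_left[OF lim0, of z]] 2 by simp
    then have "(\<lambda>n. small_t \<sigma> \<tau> n z * real n powr \<sigma>) \<longlonglongrightarrow> z" using tendsto_cong[OF eq[of \<sigma>]] by simp
    then show ?thesis using 2 by (intro exI[of _ z]) (auto simp: min_def)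
  next
    case 3
    have "(\<lambda>n. - \<tau> * real n powr (1 - 1) + z * real n powr (1 - \<sigma>)) \<longlonglongrightarrow> - \<tau> * 1 + z * 1"
      using tendsto_add[OF tendsto_mult_left[OF lim0, of "- \<tau>"] tendsto_mult_left[OF lim0, of z]] 3 by simp
    then have "(\<lambda>n. small_t \<sigma> \<tau> n z * real n powr 1) \<longlonglongrightarrow> z - \<tau>" using tendsto_cong[OF eq[of 1]] by simp
    then show ?thesis using 3 by (intro exI[of _ "z - \<tau>"]) (auto simp: min_def)
  qed
qed

lemma powr_increment: "(\<lambda>n. real (Suc n) powr s - real n powr s - s / real n * real n powr s) \<in> O_pow (s - 2)"
proof -
  have "(\<lambda>n. real n powr s * ((1 + 1 / real n) powr s - 1 - s / real n)) \<in> O_pow (s - 2)"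
    by (rule O_pow_mult[OF landau_o.big_refl one_plus_inverse_powr]) simp
  moreover have "\<forall>\<^sub>F n in sequentially. real n powr s * ((1 + 1 / real n) powr s - 1 - s / real n)
     = real (Suc n) powr s - real n powr s - s / real n * real n powr s"
    using eventually_gt_at_top[of 0]
  proof eventually_elim
    case (elim n)
    have "real (Suc n) = real n * (1 + 1 / real n)" using elim by (simp add: field_simps)
    then have "real (Suc n) powr s = real n powr s * (1 + 1 / real n) powr s"
      by (simp only: powr_mult)
    then show ?case by (simp add: algebra_simps)
  qed
  ultimately show ?thesis by (rule O_pow_cong)
qed

text \<open>The increments of a pure power follow its logarithmic derivative up to two further orders. Of the two
powers in \<open>small_t\<close> only the dominant one has the exponent \<open>\<nu>\<close>; the other one
has a different logarithmic derivative, and the gap between the exponents \<open>\<sigma>\<close> and \<open>1\<close> bounds the resulting error.\<close>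

lemma small_t_increment:
  assumes \<sigma>: "\<sigma> > 0" and \<nu>: "\<nu> = min \<sigma> 1" and \<epsilon>: "\<epsilon> \<le> 1" "\<sigma> \<noteq> 1 \<Longrightarrow> \<epsilon> \<le> \<bar>\<sigma> - 1\<bar>"
  shows "(\<lambda>n. small_t \<sigma> \<tau> (Suc n) z - small_t \<sigma> \<tau> n z + \<nu> / real n * small_t \<sigma> \<tau> n z) \<in> O_pow (- 1 - \<nu> - \<epsilon>)"
proof -
  have inv: "real n powr (-1) = 1 / real n" for n by (cases "n = 0") (auto simp: powr_minus divide_inverse)
  have main: "(\<lambda>n. k * (real (Suc n) powr (- s) - real n powr (- s) + \<nu> / real n * real n powr (- s))) \<in> O_pow (- 1 - \<nu> - \<epsilon>)"
    if s: "s \<ge> \<nu>" "s \<noteq> \<nu> \<Longrightarrow> s \<ge> \<nu> + \<epsilon>" for s k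
  proof -
    have A: "(\<lambda>n. real (Suc n) powr (- s) - real n powr (- s) - (- s) / real n * real n powr (- s)) \<in> O_pow (- 1 - \<nu> - \<epsilon>)"
      by (rule O_pow_mono[OF powr_increment]) (use s \<epsilon> in simp)
    have B: "(\<lambda>n. (\<nu> - s) / real n * real n powr (- s)) \<in> O_pow (- 1 - \<nu> - \<epsilon>)"
    proof (cases "s = \<nu>")
      case False
      show ?thesis
        by (rule O_pow_mult[OF O_pow_const_over landau_o.big_refl]) (use s False in simp)
    qed simp
    have "(\<lambda>n. real (Suc n) powr (- s) - real n powr (- s) + \<nu> / real n * real n powr (- s)) \<in> O_pow (- 1 - \<nu> - \<epsilon>)"
      by (rule O_pow_cong[OF sum_in_bigo(1)[OF A B]]) (simp add: diff_divide_distrib left_diff_distrib)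
    then show ?thesis by (cases "k = 0") simp_all
  qed
  have "\<nu> \<le> 1" "\<nu> \<le> \<sigma>" "1 \<noteq> \<nu> \<Longrightarrow> 1 \<ge> \<nu> + \<epsilon>" "\<sigma> \<noteq> \<nu> \<Longrightarrow> \<sigma> \<ge> \<nu> + \<epsilon>"
    using \<nu> \<epsilon> by (auto simp: min_def split: if_splits)
  then show ?thesis
    using sum_in_bigo(1)[OF main[of 1 "- \<tau>"] main[of \<sigma> z]] by (simp add: small_t_def inv algebra_simps)
qed

section \<open>The defect of the oscillating ansatz\<close>

definition jost_ansatz :: "real \<Rightarrow> real \<Rightarrow> (nat \<Rightarrow> real) \<Rightarrow> nat \<Rightarrow> complex" where
  "jost_ansatz \<gamma> \<rho> \<Phi> n = of_real ((- \<gamma>) ^ n * real n powr (- \<rho>)) * exp (\<i> * of_real (\<Phi> n))"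

text \<open>The defect of the ansatz at \<open>n\<close>, divided by \<open>- \<gamma> n powr \<sigma>\<close> and by the ansatz itself; see
\<open>defect_jost_ansatz\<close>. All factors are close to \<open>1\<close> and can be expanded in powers of \<open>1 / n\<close>.\<close>

definition ansatz_error ::
  "real \<Rightarrow> real \<Rightarrow> real \<Rightarrow> (nat \<Rightarrow> real) \<Rightarrow> (nat \<Rightarrow> real) \<Rightarrow> real \<Rightarrow> (nat \<Rightarrow> real) \<Rightarrow> nat \<Rightarrow> complex" where
  "ansatz_error \<gamma> \<sigma> \<rho> a b x \<theta> n =
     of_real (a n / real n powr \<sigma> * (1 + 1 / real n) powr (- \<rho>)) * cis (\<gamma> * \<theta> (Suc n))
     + of_real (a (n - 1) / real n powr \<sigma> * (1 - 1 / real n) powr (- \<rho>)) * cis (- \<gamma> * \<theta> n)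
     - of_real (2 * (b n / (2 * \<gamma> * real n powr \<sigma>)) - \<gamma> * x * real n powr (- \<sigma>))"

lemma norm_jost_ansatz:
  assumes "\<gamma> \<in> {1, -1}" shows "norm (jost_ansatz \<gamma> \<rho> \<Phi> n) = real n powr (- \<rho>)"
  using assms by (auto simp: jost_ansatz_def norm_mult norm_power)

lemma jost_ansatz_Suc:
  assumes g: "\<gamma> \<in> {1, -1}" and n: "n > 0" and \<Phi>: "\<Phi> (Suc n) = \<Phi> n + \<gamma> * s"
  shows "jost_ansatz \<gamma> \<rho> \<Phi> (Suc n) =
    of_real (- \<gamma> * (1 + 1 / real n) powr (- \<rho>)) * cis (\<gamma> * s) * jost_ansatz \<gamma> \<rho> \<Phi> n"
proof -
  have "real (Suc n) = real n * (1 + 1 / real n)" using n by (simp add: field_simps)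
  then have "real (Suc n) powr (- \<rho>) = real n powr (- \<rho>) * (1 + 1 / real n) powr (- \<rho>)"
    by (simp only: powr_mult)
  moreover have "exp (\<i> * of_real (\<Phi> (Suc n))) = cis (\<gamma> * s) * exp (\<i> * of_real (\<Phi> n))"
    by (simp add: \<Phi> cis_conv_exp exp_add[symmetric] algebra_simps)
  ultimately show ?thesis by (simp only: jost_ansatz_def power_Suc of_real_mult mult_ac)
qed

lemma jost_ansatz_pred:
  assumes g: "\<gamma> \<in> {1, -1}" and n: "n > 1" and \<Phi>: "\<Phi> n = \<Phi> (n - 1) + \<gamma> * s"
  shows "jost_ansatz \<gamma> \<rho> \<Phi> (n - 1) =
    of_real (- \<gamma> * (1 - 1 / real n) powr (- \<rho>)) * cis (- \<gamma> * s) * jost_ansatz \<gamma> \<rho> \<Phi> n"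
proof -
  have "real (n - 1) = real n * (1 - 1 / real n)" using n by (simp add: field_simps of_nat_diff)
  then have "real (n - 1) powr (- \<rho>) = real n powr (- \<rho>) * (1 - 1 / real n) powr (- \<rho>)"
    by (simp only: powr_mult)
  moreover have "exp (\<i> * of_real (\<Phi> (n - 1))) = cis (- \<gamma> * s) * exp (\<i> * of_real (\<Phi> n))"
    by (simp add: \<Phi> cis_conv_exp exp_add[symmetric] algebra_simps)
  moreover have "(- \<gamma>) ^ (n - 1) = - \<gamma> * (- \<gamma>) ^ n"
  proof -
    obtain m where "n = Suc m" using n by (cases n) auto
    then show ?thesis using g by auto
  qed
  ultimately show ?thesis by (simp only: jost_ansatz_def of_real_mult mult_ac)
qed

lemma defect_jost_ansatz:
  assumes g: "\<gamma> \<in> {1, -1}" and n: "n > 1"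
    and \<Phi>: "\<Phi> (Suc n) = \<Phi> n + \<gamma> * \<theta> (Suc n)" "\<Phi> n = \<Phi> (n - 1) + \<gamma> * \<theta> n"
  shows "defect a b x (jost_ansatz \<gamma> \<rho> \<Phi>) n =
    of_real (- \<gamma> * real n powr \<sigma>) * ansatz_error \<gamma> \<sigma> \<rho> a b x \<theta> n * jost_ansatz \<gamma> \<rho> \<Phi> n"
proof -
  have gg: "\<gamma> * \<gamma> = 1" and g0: "\<gamma> \<noteq> 0" using g by auto
  have p: "real n powr \<sigma> > 0" using n by simp
  have d: "2 * (b n / (2 * \<gamma> * real n powr \<sigma>)) * (- \<gamma> * real n powr \<sigma>) = - b n"
    using g0 p by (simp add: field_simps)
  have e: "\<gamma> * x * real n powr (- \<sigma>) * (- \<gamma> * real n powr \<sigma>) = - x"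
    using p gg by (simp add: powr_minus field_simps)
  have "of_real (- \<gamma> * real n powr \<sigma>) * ansatz_error \<gamma> \<sigma> \<rho> a b x \<theta> n
     = of_real (- \<gamma> * a n * (1 + 1 / real n) powr (- \<rho>)) * cis (\<gamma> * \<theta> (Suc n))
     + of_real (- \<gamma> * a (n - 1) * (1 - 1 / real n) powr (- \<rho>)) * cis (- \<gamma> * \<theta> n)
     - of_real ((2 * (b n / (2 * \<gamma> * real n powr \<sigma>)) - \<gamma> * x * real n powr (- \<sigma>)) * (- \<gamma> * real n powr \<sigma>))"
    using p unfolding ansatz_error_def by (simp add: algebra_simps)
  also have "(2 * (b n / (2 * \<gamma> * real n powr \<sigma>)) - \<gamma> * x * real n powr (- \<sigma>)) * (- \<gamma> * real n powr \<sigma>) = x - b n"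
    by (simp only: left_diff_distrib d e)
  finally have e: "of_real (- \<gamma> * real n powr \<sigma>) * ansatz_error \<gamma> \<sigma> \<rho> a b x \<theta> n =
      of_real (- \<gamma> * a n * (1 + 1 / real n) powr (- \<rho>)) * cis (\<gamma> * \<theta> (Suc n))
      + of_real (- \<gamma> * a (n - 1) * (1 - 1 / real n) powr (- \<rho>)) * cis (- \<gamma> * \<theta> n) - of_real (x - b n)" .
  show ?thesis
    unfolding e defect_def jost_ansatz_Suc[OF g _ \<Phi>(1), of \<rho>, OF less_trans[OF zero_less_one n]]
      jost_ansatz_pred[OF g n \<Phi>(2), of \<rho>]
    by (simp add: algebra_simps)
qed

text \<open>Let \<open>A\<^sub>n\<close> and \<open>A'\<^sub>n\<close> be the real factors in front of the two exponentials; they are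
\<open>1 + (\<alpha> - \<rho>) / n\<close> and \<open>1 + (\<alpha> - \<sigma> + \<rho>) / n\<close> up to \<open>O(1 / n\<^sup>2)\<close>. In the real part the terms of
order \<open>1 / n\<close> together with the spectral parameter form \<open>t\<^sub>n\<close>, which cancels against \<open>2 cos \<theta>\<^sub>n - 2\<close>. In the
imaginary part \<open>(A\<^sub>n - A'\<^sub>n) sin \<theta>\<^sub>n\<close> is \<open>(\<sigma> - 2 \<rho>) / n\<close> times \<open>sin \<theta>\<^sub>n\<close>; as \<open>\<sigma> - 2 \<rho> = \<nu> / 2\<close>, it
cancels against the leading term of the increment of \<open>sin \<theta>\<^sub>n\<close>.\<close>

lemma ansatz_error_estimate:
  fixes \<theta> t :: "nat \<Rightarrow> real"
  assumes g: "\<gamma> \<in> {1, -1}" and \<nu>: "0 < \<nu>" and \<epsilon>: "0 \<le> \<epsilon>" "2 * \<epsilon> \<le> \<nu>" "\<epsilon> \<le> 1 - \<nu> / 2" and \<rho>: "\<sigma> - 2 * \<rho> = \<nu> / 2"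
    and a: "(\<lambda>n. a n / real n powr \<sigma> - (1 + \<alpha> / real n)) \<in> O_pow (- 2)"
    and b: "(\<lambda>n. b n / (2 * \<gamma> * real n powr \<sigma>) - (1 + \<beta> / real n)) \<in> O_pow (- 2)"
    and t: "\<And>n. t n = - (2 * \<beta> - 2 * \<alpha> + \<sigma>) / real n + \<gamma> * x * real n powr (- \<sigma>)"
    and \<theta>: "\<theta> \<in> O_pow (- \<nu> / 2)"
    and d: "(\<lambda>n. \<theta> (Suc n) - \<theta> n) \<in> O_pow (- 1 - \<nu> / 2)"
    and inc: "(\<lambda>n. \<theta> (Suc n) - \<theta> n + \<nu> / (2 * real n) * \<theta> n) \<in> O_pow (- 1 - \<nu> / 2 - \<epsilon>)"
    and cos: "(\<lambda>n. 2 * cos (\<theta> n) - 2 + t n) \<in> O_pow (- 1 - \<nu> / 2 - \<epsilon>)"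
  shows "(\<lambda>n. norm (ansatz_error \<gamma> \<sigma> \<rho> a b x \<theta> n)) \<in> O_pow (- 1 - \<nu> / 2 - \<epsilon>)"
proof -
  let ?\<mu> = "- 1 - \<nu> / 2 - \<epsilon>"
  define A where "A n = a n / real n powr \<sigma> * (1 + 1 / real n) powr (- \<rho>)" for n
  define A' where "A' n = a (n - 1) / real n powr \<sigma> * (1 - 1 / real n) powr (- \<rho>)" for n
  define p where "p n = A n - 1 - (\<alpha> - \<rho>) / real n" for n
  define p' where "p' n = A' n - 1 - (\<alpha> - \<sigma> + \<rho>) / real n" for n
  define q where "q n = b n / (2 * \<gamma> * real n powr \<sigma>) - (1 + \<beta> / real n)" for n
  have prod: "(\<lambda>n. f n * h n - 1 - (k + l) / real n) \<in> O_pow (- 2)"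
    if f: "(\<lambda>n. f n - (1 + k / real n)) \<in> O_pow (- 2)" and h: "(\<lambda>n. h n - (1 + l / real n)) \<in> O_pow (- 2)"
    for f h :: "nat \<Rightarrow> real" and k l
  proof -
    have one: "(\<lambda>_. 1) \<in> O(\<lambda>_::nat. 1::real)" by simp
    have l1: "(\<lambda>n. 1 + k / real n) \<in> O(\<lambda>_. 1)" for k
      by (intro sum_in_bigo(1)[OF one] bounded_of_O_pow[OF O_pow_const_over]) simp
    have hb: "h \<in> O(\<lambda>_. 1)"
      using sum_in_bigo(1)[OF bounded_of_O_pow[OF h] l1[of l]] by simp
    have 1: "(\<lambda>n. (f n - (1 + k / real n)) * h n) \<in> O_pow (- 2)" by (rule O_pow_mult_bounded[OF f hb])
    have 2: "(\<lambda>n. (h n - (1 + l / real n)) * (1 + k / real n)) \<in> O_pow (- 2)" by (rule O_pow_mult_bounded[OF h l1])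
    have 3: "(\<lambda>n. k / real n * (l / real n)) \<in> O_pow (- 2)" by (rule O_pow_mult[OF O_pow_const_over O_pow_const_over]) simp
    show ?thesis
      by (rule O_pow_cong[OF sum_in_bigo(1)[OF sum_in_bigo(1)[OF 1 2] 3]])
         (simp add: algebra_simps add_divide_distrib)
  qed
  have p: "p \<in> O_pow (- 2)"
  proof -
    have "(\<lambda>n. (1 + 1 / real n) powr (- \<rho>) - (1 + (- \<rho>) / real n)) \<in> O_pow (- 2)"
      by (rule O_pow_cong[OF one_plus_inverse_powr[of "- \<rho>"]]) simp
    from prod[OF a this] show ?thesis unfolding p_def[abs_def] A_def by simp
  qed
  have p': "p' \<in> O_pow (- 2)"
  proof -
    \<comment> \<open>The expansion of \<open>a\<close> is applied at \<open>n - 1\<close>; passing from the power of \<open>n - 1\<close> to the power of \<open>n\<close>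
contributes the exponent \<open>\<sigma>\<close>.\<close>
    define f where "f n = a (n - 1) / real (n - 1) powr \<sigma>" for n
    have "(\<lambda>n. f n - (1 + \<alpha> / real (n - 1))) \<in> O_pow (- 2)" using O_pow_pred[OF a] by (simp add: f_def)
    moreover have "(\<lambda>n. \<alpha> / real (n - 1) - \<alpha> / real n) \<in> O_pow (- 2)" by real_asymp
    ultimately have "(\<lambda>n. (f n - (1 + \<alpha> / real (n - 1))) + (\<alpha> / real (n - 1) - \<alpha> / real n)) \<in> O_pow (- 2)"
      by (rule sum_in_bigo(1))
    then have f: "(\<lambda>n. f n - (1 + \<alpha> / real n)) \<in> O_pow (- 2)" by (rule O_pow_cong) simp
    have h: "(\<lambda>n. (1 - 1 / real n) powr (\<sigma> - \<rho>) - (1 + (\<rho> - \<sigma>) / real n)) \<in> O_pow (- 2)"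
      by (rule O_pow_cong[OF one_minus_inverse_powr[of "\<sigma> - \<rho>"]]) (simp add: diff_divide_distrib)
    show ?thesis
    proof (rule O_pow_cong[OF prod[OF f h]])
      show "\<forall>\<^sub>F n in sequentially. f n * (1 - 1 / real n) powr (\<sigma> - \<rho>) - 1 - (\<alpha> + (\<rho> - \<sigma>)) / real n = p' n"
        using eventually_gt_at_top[of 1]
      proof eventually_elim
        case (elim n)
        have e: "real (n - 1) = real n * (1 - 1 / real n)" using elim by (simp add: field_simps of_nat_diff)
        have "1 - 1 / real n > 0" using elim by simp
        then have "f n * (1 - 1 / real n) powr (\<sigma> - \<rho>) = A' n"
          unfolding f_def A'_def e powr_mult powr_diff powr_minus by (simp add: field_simps)
        then show ?case by (simp add: p'_def algebra_simps)
      qed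
    qed
  qed
  have q: "q \<in> O_pow (- 2)" using b by (simp add: q_def[abs_def])
  note trig = trig_increments[OF \<nu> \<epsilon>(1) _ \<theta> d inc]
  have \<epsilon>\<nu>: "\<epsilon> \<le> \<nu>" using \<epsilon> \<nu> by simp
  have mono2: "f \<in> O_pow (- 2) \<Longrightarrow> f \<in> O_pow ?\<mu>" for f by (rule O_pow_mono) (use \<epsilon> in auto)
  have mono\<nu>: "f \<in> O_pow (- 1 - \<nu>) \<Longrightarrow> f \<in> O_pow ?\<mu>" for f by (rule O_pow_mono) (use \<epsilon> in auto)
  have cosb: "(\<lambda>n. cos (f n)) \<in> O(\<lambda>_. 1)" "(\<lambda>n. sin (f n)) \<in> O(\<lambda>_. 1)" for f :: "nat \<Rightarrow> real"
    by (intro bigoI[of _ 1] always_eventually; simp)+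
  have c0: "(\<lambda>n. cos (\<theta> n) - 1) \<in> O_pow (- \<nu>)"
  proof (rule O_pow_le)
    show "(\<lambda>n. \<theta> n * \<theta> n) \<in> O_pow (- \<nu>)" by (rule O_pow_mult[OF \<theta> \<theta>]) simp
    show "\<forall>\<^sub>F n in sequentially. norm (cos (\<theta> n) - 1) \<le> norm (\<theta> n * \<theta> n)"
      by (intro always_eventually allI) (use abs_one_minus_cos_le in \<open>simp add: power2_eq_square\<close>)
  qed
  have c1: "(\<lambda>n. cos (\<theta> (Suc n)) - 1) \<in> O_pow (- \<nu>)" by (rule O_pow_Suc[OF c0])
  have R: "(\<lambda>n. A n * cos (\<theta> (Suc n)) + A' n * cos (\<theta> n)
      - (2 * (b n / (2 * \<gamma> * real n powr \<sigma>)) - \<gamma> * x * real n powr (- \<sigma>))) \<in> O_pow ?\<mu>"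
  proof -
    have 1: "(\<lambda>n. (\<alpha> - \<rho>) / real n * (cos (\<theta> (Suc n)) - 1)) \<in> O_pow ?\<mu>"
      by (rule mono\<nu>[OF O_pow_mult[OF O_pow_const_over c1]]) simp
    have 2: "(\<lambda>n. (\<alpha> - \<sigma> + \<rho>) / real n * (cos (\<theta> n) - 1)) \<in> O_pow ?\<mu>"
      by (rule mono\<nu>[OF O_pow_mult[OF O_pow_const_over c0]]) simp
    have 3: "(\<lambda>n. p n * cos (\<theta> (Suc n))) \<in> O_pow ?\<mu>" by (rule mono2[OF O_pow_mult_bounded[OF p cosb(1)]])
    have 4: "(\<lambda>n. p' n * cos (\<theta> n)) \<in> O_pow ?\<mu>" by (rule mono2[OF O_pow_mult_bounded[OF p' cosb(1)]])
    have 5: "(\<lambda>n. - 2 * q n) \<in> O_pow ?\<mu>" using mono2[OF q] by simp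
    show ?thesis
    proof (rule O_pow_cong[OF sum_in_bigo(1)[OF sum_in_bigo(1)[OF sum_in_bigo(1)[OF sum_in_bigo(1)[OF
        sum_in_bigo(1)[OF sum_in_bigo(1)[OF cos mono\<nu>[OF trig(1)[OF \<epsilon>\<nu>]]] 1] 2] 3] 4] 5]])
      have "(\<alpha> - \<rho>) / real n + (\<alpha> - \<sigma> + \<rho>) / real n - 2 * (\<beta> / real n) + \<gamma> * x * real n powr (- \<sigma>) = t n" for n
        unfolding t by (simp add: add_divide_distrib diff_divide_distrib)
      moreover have "2 * c - 2 + t' + (C - c) + k * (C - 1) + k' * (c - 1) + (B - 1 - k) * C + (B' - 1 - k') * c
          + - 2 * (B'' - (1 + k'')) = B * C + B' * c - (2 * B'' - u)"
        if "k + k' - 2 * k'' + u = t'" for c C k k' k'' B B' B'' u t' :: real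
        unfolding that[symmetric] by (simp add: algebra_simps)
      ultimately show "\<forall>\<^sub>F n in sequentially.
         2 * cos (\<theta> n) - 2 + t n + (cos (\<theta> (Suc n)) - cos (\<theta> n)) +
         (\<alpha> - \<rho>) / real n * (cos (\<theta> (Suc n)) - 1) + (\<alpha> - \<sigma> + \<rho>) / real n * (cos (\<theta> n) - 1) +
         p n * cos (\<theta> (Suc n)) + p' n * cos (\<theta> n) + - 2 * q n =
         A n * cos (\<theta> (Suc n)) + A' n * cos (\<theta> n) -
         (2 * (b n / (2 * \<gamma> * real n powr \<sigma>)) - \<gamma> * x * real n powr (- \<sigma>))"
        unfolding p_def p'_def q_def by (intro always_eventually allI) blast
    qed
  qed
  have I: "(\<lambda>n. A n * sin (\<theta> (Suc n)) - A' n * sin (\<theta> n)) \<in> O_pow ?\<mu>"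
  proof -
    have 1: "(\<lambda>n. (\<alpha> - \<rho>) / real n * (sin (\<theta> (Suc n)) - sin (\<theta> n))) \<in> O_pow ?\<mu>"
      by (rule O_pow_mult[OF O_pow_const_over trig(2)[OF \<epsilon>\<nu>]]) (use \<epsilon> in simp)
    have 2: "(\<lambda>n. p n * sin (\<theta> (Suc n))) \<in> O_pow ?\<mu>" by (rule mono2[OF O_pow_mult_bounded[OF p cosb(2)]])
    have 3: "(\<lambda>n. p' n * sin (\<theta> n)) \<in> O_pow ?\<mu>" by (rule mono2[OF O_pow_mult_bounded[OF p' cosb(2)]])
    show ?thesis
    proof (rule O_pow_cong[OF sum_in_bigo(2)[OF sum_in_bigo(1)[OF sum_in_bigo(1)[OF trig(3)[OF \<epsilon>\<nu>] 1] 2] 3]])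
      have "\<nu> / (2 * real n) = (\<alpha> - \<rho>) / real n - (\<alpha> - \<sigma> + \<rho>) / real n" for n
      proof -
        have "\<nu> / (2 * real n) = (\<sigma> - 2 * \<rho>) / real n" unfolding \<rho> by simp
        then show ?thesis by (simp add: diff_divide_distrib add_divide_distrib)
      qed
      moreover have "s' - s + k0 * s + k * (s' - s) + (B - 1 - k) * s' - (B' - 1 - k') * s = B * s' - B' * s"
        if "k0 = k - k'" for s s' k k' k0 B B' :: real
        unfolding that by (simp add: algebra_simps)
      ultimately show "\<forall>\<^sub>F n in sequentially.
         sin (\<theta> (Suc n)) - sin (\<theta> n) + \<nu> / (2 * real n) * sin (\<theta> n) +
         (\<alpha> - \<rho>) / real n * (sin (\<theta> (Suc n)) - sin (\<theta> n)) + p n * sin (\<theta> (Suc n)) - p' n * sin (\<theta> n) =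
         A n * sin (\<theta> (Suc n)) - A' n * sin (\<theta> n)"
        unfolding p_def p'_def by (intro always_eventually allI) blast
    qed
  qed
  show ?thesis
  proof (rule O_pow_le)
    let ?R = "\<lambda>n. A n * cos (\<theta> (Suc n)) + A' n * cos (\<theta> n)
      - (2 * (b n / (2 * \<gamma> * real n powr \<sigma>)) - \<gamma> * x * real n powr (- \<sigma>))"
    let ?I = "\<lambda>n. A n * sin (\<theta> (Suc n)) - A' n * sin (\<theta> n)"
    have "(\<lambda>n. norm (?R n)) \<in> O_pow ?\<mu>" "(\<lambda>n. norm (?I n)) \<in> O_pow ?\<mu>" using R I by simp_all
    then show "(\<lambda>n. norm (?R n) + norm (?I n)) \<in> O_pow ?\<mu>" by (rule sum_in_bigo(1))
    have "norm (ansatz_error \<gamma> \<sigma> \<rho> a b x \<theta> n) \<le> norm (?R n) + norm (?I n)" for n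
    proof -
      have "Re (ansatz_error \<gamma> \<sigma> \<rho> a b x \<theta> n) = ?R n"
        using g by (auto simp: ansatz_error_def A_def A'_def)
      moreover have "\<bar>Im (ansatz_error \<gamma> \<sigma> \<rho> a b x \<theta> n)\<bar> = \<bar>?I n\<bar>"
        using g by (auto simp: ansatz_error_def A_def A'_def)
      ultimately show ?thesis using cmod_le[of "ansatz_error \<gamma> \<sigma> \<rho> a b x \<theta> n"] by simp
    qed
    then show "\<forall>\<^sub>F n in sequentially. norm (norm (ansatz_error \<gamma> \<sigma> \<rho> a b x \<theta> n)) \<le> norm (norm (?R n) + norm (?I n))"
      by (intro always_eventually allI) simp
  qed
qed


lemma casoratian_jost_ansatz:
  assumes g: "\<gamma> \<in> {1, -1}" and n: "n > 0" and \<Phi>: "\<Phi> (Suc n) = \<Phi> n + \<gamma> * s"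
  shows "casoratian a (jost_ansatz \<gamma> \<rho> \<Phi>) (\<lambda>n. cnj (jost_ansatz \<gamma> \<rho> \<Phi> n)) n =
    2 * \<i> * of_real (a n * real n powr (- 2 * \<rho>) * (1 + 1 / real n) powr (- \<rho>) * sin s)"
proof -
  let ?Q = "jost_ansatz \<gamma> \<rho> \<Phi> n" and ?k = "- \<gamma> * (1 + 1 / real n) powr (- \<rho>)"
  have "cnj ?Q * ?Q = of_real ((norm ?Q)\<^sup>2)" by (simp only: complex_norm_square mult.commute)
  also have "(norm ?Q)\<^sup>2 = real n powr (- 2 * \<rho>)"
    using n by (simp add: norm_jost_ansatz[OF g] power2_eq_square powr_add[symmetric])
  finally have QQ: "cnj ?Q * ?Q = of_real (real n powr (- 2 * \<rho>))" .
  have "cnj (cis (\<gamma> * s)) - cis (\<gamma> * s) = - 2 * \<i> * of_real (\<gamma> * sin s)"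
    using g by (auto simp: complex_eq_iff)
  then have "of_real ?k * (cnj (cis (\<gamma> * s)) - cis (\<gamma> * s)) = of_real ?k * (- 2 * \<i> * of_real (\<gamma> * sin s))"
    by (rule arg_cong)
  also have "\<dots> = 2 * \<i> * of_real ((\<gamma> * \<gamma>) * ((1 + 1 / real n) powr (- \<rho>) * sin s))" by simp
  also have "\<gamma> * \<gamma> = 1" using g by auto
  finally have "of_real ?k * (cnj (cis (\<gamma> * s)) - cis (\<gamma> * s)) = 2 * \<i> * of_real ((1 + 1 / real n) powr (- \<rho>) * sin s)"
    by simp
  moreover have "casoratian a (jost_ansatz \<gamma> \<rho> \<Phi>) (\<lambda>n. cnj (jost_ansatz \<gamma> \<rho> \<Phi> n)) n =
     of_real (a n) * (of_real ?k * (cnj (cis (\<gamma> * s)) - cis (\<gamma> * s))) * (cnj ?Q * ?Q)"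
    unfolding casoratian_def jost_ansatz_Suc[OF g n \<Phi>] complex_cnj_mult complex_cnj_complex_of_real
    by (simp only: right_diff_distrib left_diff_distrib mult_ac)
  ultimately show ?thesis unfolding QQ by (simp add: mult_ac)
qed

text \<open>The amplitude of the ansatz squared times \<open>n powr \<sigma>\<close> is \<open>n powr (\<nu> / 2)\<close>. This factor turns the decay of
\<open>sin \<theta>\<^sub>n\<^sub>+\<^sub>1\<close> into the positive limit \<open>sqrt c\<close>, and it costs exactly the \<open>\<nu> / 2\<close> that the error estimate provides
beyond the summable order \<open>1 + \<epsilon>\<close>.\<close>

lemma jacobi_ansatz_jost:
  fixes \<theta> t :: "nat \<Rightarrow> real"
  assumes g: "\<gamma> \<in> {1, -1}" and \<nu>: "0 < \<nu>" "\<nu> \<le> 1" and \<epsilon>: "0 < \<epsilon>" "2 * \<epsilon> \<le> \<nu>" and \<rho>: "\<sigma> - 2 * \<rho> = \<nu> / 2"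
    and a_pos: "\<And>n. a n > 0"
    and a: "(\<lambda>n. a n / real n powr \<sigma> - (1 + \<alpha> / real n)) \<in> O_pow (- 2)"
    and b: "(\<lambda>n. b n / (2 * \<gamma> * real n powr \<sigma>) - (1 + \<beta> / real n)) \<in> O_pow (- 2)"
    and t: "\<And>n. t n = - (2 * \<beta> - 2 * \<alpha> + \<sigma>) / real n + \<gamma> * x * real n powr (- \<sigma>)"
    and T: "(\<lambda>n. T n * real n powr \<nu>) \<longlonglongrightarrow> c" "c > 0"
    and T_inc: "(\<lambda>n. T (Suc n) - T n + \<nu> / real n * T n) \<in> O_pow (- 1 - \<nu> - \<epsilon>)"
    and T_pos: "\<And>n. n \<ge> N \<Longrightarrow> T n > 0"
    and cos: "(\<lambda>n. 2 * cos (sqrt (T n)) - 2 + t n) \<in> O_pow (- 1 - \<nu> / 2 - \<epsilon>)"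
  shows "jacobi_ansatz a b x (jost_ansatz \<gamma> \<rho> (\<lambda>n. \<gamma> * (\<Sum>m=N..n. sqrt (T m)))) (sqrt c)"
proof
  define \<theta> where "\<theta> n = sqrt (T n)" for n
  define \<Phi> where "\<Phi> n = \<gamma> * (\<Sum>m=N..n. sqrt (T m))" for n
  define Q where "Q = jost_ansatz \<gamma> \<rho> \<Phi>"
  have Q: "jost_ansatz \<gamma> \<rho> (\<lambda>n. \<gamma> * (\<Sum>m=N..n. sqrt (T m))) = Q" by (simp add: Q_def \<Phi>_def[abs_def])
  have step: "\<Phi> (Suc n) = \<Phi> n + \<gamma> * \<theta> (Suc n)" if "Suc n \<ge> N" for n
    using that by (simp add: \<Phi>_def \<theta>_def sum.nat_ivl_Suc' algebra_simps)
  have lim: "(\<lambda>n. \<theta> n * real n powr (\<nu> / 2)) \<longlonglongrightarrow> sqrt c" unfolding \<theta>_def by (rule sqrt_power_law[OF T(1)])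
  have \<theta>O: "\<theta> \<in> O_pow (- \<nu> / 2)" using O_pow_of_lim[OF lim] by simp
  have \<theta>0: "\<theta> \<longlonglongrightarrow> 0" using O_pow_tendsto_0[OF \<theta>O] \<nu> by simp
  show "a n > 0" for n by (rule a_pos)
  show "sqrt c > 0" using T by simp
  show "\<forall>\<^sub>F n in sequentially. jost_ansatz \<gamma> \<rho> (\<lambda>n. \<gamma> * (\<Sum>m=N..n. sqrt (T m))) n \<noteq> 0"
    unfolding Q using eventually_gt_at_top[of 0]
  proof eventually_elim
    case (elim n)
    then have "norm (Q n) > 0" unfolding Q_def norm_jost_ansatz[OF g] by simp
    then show ?case by simp
  qed
  show "casoratian a (jost_ansatz \<gamma> \<rho> (\<lambda>n. \<gamma> * (\<Sum>m=N..n. sqrt (T m))))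
     (\<lambda>n. cnj (jost_ansatz \<gamma> \<rho> (\<lambda>n. \<gamma> * (\<Sum>m=N..n. sqrt (T m))) n)) \<longlonglongrightarrow> 2 * \<i> * of_real (sqrt c)"
    unfolding Q
  proof -
    have "(\<lambda>n. a n / real n powr \<sigma> - (1 + \<alpha> / real n)) \<longlonglongrightarrow> 0" using O_pow_tendsto_0[OF a] by simp
    moreover have "(\<lambda>n. 1 + \<alpha> / real n) \<longlonglongrightarrow> 1" by real_asymp
    ultimately have "(\<lambda>n. (a n / real n powr \<sigma> - (1 + \<alpha> / real n)) + (1 + \<alpha> / real n)) \<longlonglongrightarrow> 0 + 1"
      by (rule tendsto_add)
    then have la: "(\<lambda>n. a n / real n powr \<sigma>) \<longlonglongrightarrow> 1" by simp
    have lp: "(\<lambda>n. (1 + 1 / real n) powr (- \<rho>)) \<longlonglongrightarrow> 1" by real_asymp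
    have lq: "(\<lambda>n::nat. real n powr (\<nu> / 2) / real (Suc n) powr (\<nu> / 2)) \<longlonglongrightarrow> 1" by real_asymp
    have ls: "(\<lambda>n. sin (\<theta> (Suc n)) / \<theta> (Suc n)) \<longlonglongrightarrow> 1"
    proof -
      have "\<forall>\<^sub>F n in sequentially. \<theta> (Suc n) \<noteq> 0"
        using eventually_ge_at_top[of N]
      proof eventually_elim
        case (elim n)
        then show ?case using T_pos[of "Suc n"] by (simp add: \<theta>_def)
      qed
      then have "filterlim (\<lambda>n. \<theta> (Suc n)) (at 0) sequentially"
        using LIMSEQ_Suc[OF \<theta>0] by (simp add: filterlim_at)
      moreover have "((\<lambda>y::real. sin y / y) \<longlongrightarrow> 1) (at 0)" by real_asymp
      ultimately show ?thesis by (rule filterlim_compose[rotated])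
    qed
    have "(\<lambda>n. a n / real n powr \<sigma> * (1 + 1 / real n) powr (- \<rho>) *
        (real n powr (\<nu> / 2) / real (Suc n) powr (\<nu> / 2)) * (\<theta> (Suc n) * real (Suc n) powr (\<nu> / 2)) *
        (sin (\<theta> (Suc n)) / \<theta> (Suc n))) \<longlonglongrightarrow> 1 * 1 * 1 * sqrt c * 1"
      by (intro tendsto_mult la lp lq LIMSEQ_Suc[OF lim] ls)
    then have "(\<lambda>n. 2 * \<i> * of_real (a n / real n powr \<sigma> * (1 + 1 / real n) powr (- \<rho>) *
        (real n powr (\<nu> / 2) / real (Suc n) powr (\<nu> / 2)) * (\<theta> (Suc n) * real (Suc n) powr (\<nu> / 2)) *
        (sin (\<theta> (Suc n)) / \<theta> (Suc n)))) \<longlonglongrightarrow> 2 * \<i> * of_real (1 * 1 * 1 * sqrt c * 1)"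
      by (rule tendsto_mult[OF tendsto_const tendsto_of_real])
    moreover have "\<forall>\<^sub>F n in sequentially. 2 * \<i> * of_real (a n / real n powr \<sigma> * (1 + 1 / real n) powr (- \<rho>) *
        (real n powr (\<nu> / 2) / real (Suc n) powr (\<nu> / 2)) * (\<theta> (Suc n) * real (Suc n) powr (\<nu> / 2)) *
        (sin (\<theta> (Suc n)) / \<theta> (Suc n))) = casoratian a Q (\<lambda>n. cnj (Q n)) n"
      using eventually_ge_at_top[of N] eventually_gt_at_top[of 0]
    proof eventually_elim
      case (elim n)
      have n: "Suc n \<ge> N" using elim by simp
      have th: "\<theta> (Suc n) > 0" using T_pos[OF n] by (simp add: \<theta>_def)
      have "real n powr (- 2 * \<rho>) = real n powr (\<nu> / 2 - \<sigma>)" by (simp add: \<rho>[symmetric])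
      also have "\<dots> = real n powr (\<nu> / 2) / real n powr \<sigma>" by (rule powr_diff)
      finally have pw: "real n powr (- 2 * \<rho>) = real n powr (\<nu> / 2) / real n powr \<sigma>" .
      have S: "real (Suc n) powr (\<nu> / 2) \<noteq> 0" by simp
      show ?case
        unfolding Q_def casoratian_jost_ansatz[OF g elim(2) step[OF n]] pw
        using th S by (simp add: field_simps del: of_nat_Suc)
    qed
    ultimately have "casoratian a Q (\<lambda>n. cnj (Q n)) \<longlonglongrightarrow> 2 * \<i> * of_real (1 * 1 * 1 * sqrt c * 1)"
      by (rule Lim_transform_eventually)
    then show "casoratian a Q (\<lambda>n. cnj (Q n)) \<longlonglongrightarrow> 2 * \<i> * of_real (sqrt c)" by simp
  qed
  have e1: "\<epsilon> \<le> 1" "\<epsilon> \<le> 1 - \<nu> / 2" using \<epsilon> \<nu> by simp_all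
  note inc = sqrt_increment[OF T \<epsilon>(1) e1(1) T_inc]
  have err: "(\<lambda>n. norm (ansatz_error \<gamma> \<sigma> \<rho> a b x \<theta> n)) \<in> O_pow (- 1 - \<nu> / 2 - \<epsilon>)"
    by (rule ansatz_error_estimate[OF g \<nu>(1) less_imp_le[OF \<epsilon>(1)] \<epsilon>(2) e1(2) \<rho> a b t \<theta>O])
       (use inc cos in \<open>simp_all add: \<theta>_def\<close>)
  show "summable (\<lambda>n. norm (jost_ansatz \<gamma> \<rho> (\<lambda>n. \<gamma> * (\<Sum>m=N..n. sqrt (T m))) n) *
     norm (defect a b x (jost_ansatz \<gamma> \<rho> (\<lambda>n. \<gamma> * (\<Sum>m=N..n. sqrt (T m)))) n))"
    unfolding Q
  proof (rule summable_comparison_test_bigo)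
    show "summable (\<lambda>n. norm (real n powr (- 1 - \<epsilon>)))"
      using \<epsilon> by (simp add: summable_real_powr_iff)
    have "(\<lambda>n. real n powr (\<nu> / 2) * norm (ansatz_error \<gamma> \<sigma> \<rho> a b x \<theta> n)) \<in> O_pow (- 1 - \<epsilon>)"
      by (rule O_pow_mult[OF landau_o.big_refl err]) simp
    then show "(\<lambda>n. norm (Q n) * norm (defect a b x Q n)) \<in> O_pow (- 1 - \<epsilon>)"
    proof (rule O_pow_cong)
      show "\<forall>\<^sub>F n in sequentially. real n powr (\<nu> / 2) * norm (ansatz_error \<gamma> \<sigma> \<rho> a b x \<theta> n) =
          norm (Q n) * norm (defect a b x Q n)"
        using eventually_ge_at_top[of N] eventually_gt_at_top[of 1]
      proof eventually_elim
        case (elim n)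
        have s: "\<Phi> (Suc n) = \<Phi> n + \<gamma> * \<theta> (Suc n)" "\<Phi> n = \<Phi> (n - 1) + \<gamma> * \<theta> n"
          using step[of n] step[of "n - 1"] elim by auto
        have "norm (defect a b x Q n) = real n powr \<sigma> * norm (ansatz_error \<gamma> \<sigma> \<rho> a b x \<theta> n) * norm (Q n)"
          unfolding Q_def defect_jost_ansatz[OF g elim(2) s, of a b x \<rho> \<sigma>] using g by (auto simp: norm_mult)
        moreover have "norm (Q n) * real n powr \<sigma> * norm (Q n) = real n powr (\<nu> / 2)"
          unfolding Q_def norm_jost_ansatz[OF g] powr_add[symmetric] by (simp add: \<rho>[symmetric])
        ultimately show ?case by (simp add: mult_ac)
      qed
    qed
  qed
  show "\<not> convergent (\<lambda>n. cnj (jost_ansatz \<gamma> \<rho> (\<lambda>n. \<gamma> * (\<Sum>m=N..n. sqrt (T m))) n) /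
     jost_ansatz \<gamma> \<rho> (\<lambda>n. \<gamma> * (\<Sum>m=N..n. sqrt (T m))) n)"
    unfolding Q
  proof
    assume conv: "convergent (\<lambda>n. cnj (Q n) / Q n)"
    \<comment> \<open>The quotient is \<open>cis (- \<gamma> \<psi>\<^sub>n)\<close>; conjugating it for \<open>\<gamma> = 1\<close> reduces both signs to an increasing phase.\<close>
    define \<psi> where "\<psi> n = 2 * (\<Sum>m=N..n. \<theta> m)" for n
    have "filterlim (\<lambda>n. \<Sum>m=N..n. \<theta> m) at_top sequentially"
    proof (rule filterlim_sum_power_law_at_top[OF lim])
      show "\<theta> n \<ge> 0" if "n \<ge> N" for n using T_pos[OF that] by (simp add: \<theta>_def)
    qed (use T \<nu> in simp_all)
    then have top: "filterlim \<psi> at_top sequentially"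
      unfolding \<psi>_def by (intro filterlim_tendsto_pos_mult_at_top[OF tendsto_const]) auto
    have "\<forall>\<^sub>F n in sequentially. 2 * \<theta> (Suc n) = \<psi> (Suc n) - \<psi> n"
      using eventually_ge_at_top[of N] by eventually_elim (simp add: \<psi>_def sum.nat_ivl_Suc')
    moreover have "(\<lambda>n. 2 * \<theta> (Suc n)) \<longlonglongrightarrow> 0"
      using tendsto_mult_left[OF LIMSEQ_Suc[OF \<theta>0], of 2] by simp
    ultimately have inc0: "(\<lambda>n. \<psi> (Suc n) - \<psi> n) \<longlonglongrightarrow> 0" by (rule Lim_transform_eventually[rotated])
    have ev: "\<forall>\<^sub>F n in sequentially. (if \<gamma> = 1 then cnj (cnj (Q n) / Q n) else cnj (Q n) / Q n) = cis (\<psi> n)"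
      using eventually_gt_at_top[of 0]
    proof eventually_elim
      case (elim n)
      let ?r = "(- \<gamma>) ^ n * real n powr (- \<rho>)"
      have r: "?r \<noteq> 0" "\<gamma> \<noteq> 0" using g elim by auto
      have Qn: "Q n = of_real ?r * cis (\<gamma> * (\<psi> n / 2))"
        by (simp add: Q_def jost_ansatz_def \<Phi>_def \<psi>_def \<theta>_def cis_conv_exp)
      have "cnj (Q n) / Q n = cis (- \<gamma> * (\<psi> n / 2)) / cis (\<gamma> * (\<psi> n / 2))"
        unfolding Qn complex_cnj_mult complex_cnj_complex_of_real using r by (simp add: cis_cnj)
      also have "\<dots> = cis (- \<gamma> * \<psi> n)" by (simp add: cis_divide)
      finally show ?case using g by (auto simp: cis_cnj)
    qed
    have "convergent (\<lambda>n. if \<gamma> = 1 then cnj (cnj (Q n) / Q n) else cnj (Q n) / Q n)"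
    proof (cases "\<gamma> = 1")
      case True
      obtain l where "(\<lambda>n. cnj (Q n) / Q n) \<longlonglongrightarrow> l" using conv by (auto simp: convergent_def)
      then have "convergent (\<lambda>n. cnj (cnj (Q n) / Q n))" using tendsto_cnj convergentI by blast
      then show ?thesis using True by simp
    qed (use conv in simp)
    then have "convergent (\<lambda>n. cis (\<psi> n))" using convergent_cong[OF ev] by simp
    then show False using not_convergent_cis[OF top inc0] by simp
  qed
qed

section \<open>Asymptotics of the orthonormal polynomials\<close>

lemma rho_min: "\<sigma> - 2 * rho \<sigma> = min \<sigma> 1 / 2"
  by (simp add: rho_def min_def)

text \<open>The three cases are treated at once with \<open>\<nu> = min \<sigma> 1\<close>. For \<open>\<sigma> \<ge> 1\<close> the absence of a correction is the
correction polynomial of degree \<open>1\<close>, which is \<open>0\<close>, and \<open>(1 + 1/2) \<nu> > 1\<close> holds like the condition on \<open>L\<close> for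
\<open>\<sigma> < 1\<close>.\<close>

lemma jacobi_ansatz_of_assumptions:
  fixes \<gamma> \<sigma> \<alpha> \<beta> \<tau> x :: real and a b :: "nat \<Rightarrow> real" and L N :: nat
  assumes g: "\<gamma> \<in> {1, -1}"
    and \<sigma>: "0 < \<sigma>"
    and a_pos: "\<And>n. a n > 0"
    and a: "(\<lambda>n. a n / real n powr \<sigma> - (1 + \<alpha> / real n)) \<in> O(\<lambda>n. 1 / real n ^ 2)"
    and b: "(\<lambda>n. b n / (2 * \<gamma> * real n powr \<sigma>) - (1 + \<beta> / real n)) \<in> O(\<lambda>n. 1 / real n ^ 2)"
    and \<tau>: "\<tau> = 2 * \<beta> - 2 * \<alpha> + \<sigma>"
    and cases: "(1 < \<sigma> \<and> \<tau> < 0) \<or> (\<sigma> < 1 \<and> \<gamma> * x > 0) \<or> (\<sigma> = 1 \<and> \<gamma> * x > \<tau>)"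
    and L: "L \<ge> 1" "\<sigma> < 1 \<Longrightarrow> (real L + 1 / 2) * \<sigma> > 1"
    and T_pos: "\<And>m. m \<ge> N \<Longrightarrow> big_T \<sigma> \<tau> L m (\<gamma> * x) > 0"
  shows "\<exists>w. jacobi_ansatz a b x (jost_ansatz \<gamma> (rho \<sigma>) (jost_phase \<gamma> \<sigma> \<tau> L N x)) w"
proof -
  define \<nu> where "\<nu> = min \<sigma> 1"
  define K where "K = (if \<sigma> \<ge> 1 then 1 else L)"
  define p where "p = corr_poly K"
  have \<nu>: "0 < \<nu>" "\<nu> \<le> 1" using \<sigma> by (auto simp: \<nu>_def)
  have K: "K \<ge> 1" "(real K + 1 / 2) * \<nu> > 1" using L by (auto simp: K_def \<nu>_def)
  have p: "is_corr_poly K p" unfolding p_def by (rule is_corr_poly_corr_poly[OF K(1)])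
  have p0: "p = 0" if "\<sigma> \<ge> 1"
  proof -
    have "is_corr_poly 1 0" by (auto simp: is_corr_poly_def)
    then show ?thesis using corr_poly_unique[OF _ p] that by (simp add: K_def)
  qed
  define t where "t n = small_t \<sigma> \<tau> n (\<gamma> * x)" for n
  define T where "T n = t n + poly p (t n)" for n
  have bigT: "big_T \<sigma> \<tau> L n (\<gamma> * x) = T n" for n
    using p0 by (auto simp: big_T_def T_def t_def p_def K_def)
  \<comment> \<open>The three entries bound, in this order, the products of two small terms, the Taylor remainder of the
cosine, and the error from the subordinate power in \<open>small_t\<close>; for \<open>\<sigma> = 1\<close> there is no such power, and
\<open>1\<close> is a harmless default.\<close>
  define \<epsilon> where "\<epsilon> = Min {\<nu> / 2, (real K + 1 / 2) * \<nu> - 1, if \<sigma> = 1 then 1 else \<bar>\<sigma> - 1\<bar>}"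
  have "\<epsilon> > 0" using \<nu> K by (auto simp: \<epsilon>_def)
  moreover have "\<epsilon> \<le> \<nu> / 2" "\<epsilon> \<le> (real K + 1 / 2) * \<nu> - 1" "\<epsilon> \<le> (if \<sigma> = 1 then 1 else \<bar>\<sigma> - 1\<bar>)"
    unfolding \<epsilon>_def by (intro Min_le; simp)+
  ultimately have \<epsilon>: "\<epsilon> > 0" "2 * \<epsilon> \<le> \<nu>" "\<epsilon> \<le> \<nu>" "\<epsilon> \<le> 1" "\<epsilon> \<le> (real K + 1 / 2) * \<nu> - 1"
    "\<sigma> \<noteq> 1 \<Longrightarrow> \<epsilon> \<le> \<bar>\<sigma> - 1\<bar>" using \<nu> by auto
  obtain c where c: "c > 0" "(\<lambda>n. t n * real n powr \<nu>) \<longlonglongrightarrow> c"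
    using small_t_power_law[OF \<sigma> cases] by (auto simp: t_def \<nu>_def)
  have inc: "(\<lambda>n. t (Suc n) - t n + \<nu> / real n * t n) \<in> O_pow (- 1 - \<nu> - \<epsilon>)"
    unfolding t_def by (rule small_t_increment[OF \<sigma> \<nu>_def \<epsilon>(4,6)])
  have X: "monom 1 2 dvd p" using p unfolding is_corr_poly_iff[OF K(1)] by blast
  note T = corrected_power_law[OF \<nu>(1) \<epsilon>(3) X c(2) inc \<epsilon>(1), folded T_def]
  have tO: "t \<in> O_pow (- \<nu>)" by (rule O_pow_of_lim[OF c(2)])
  have pos: "T n > 0" if "n \<ge> N" for n using T_pos[OF that] by (simp add: bigT)
  have "\<forall>\<^sub>F n in sequentially. t n + poly p (t n) \<ge> 0"
    using eventually_ge_at_top[of N]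
  proof eventually_elim
    case (elim n)
    then show ?case using pos[of n] by (simp add: T_def)
  qed
  from corr_poly_cos_residual[OF K(1) p less_imp_le[OF \<nu>(1)] tO this, folded T_def]
  have cos: "(\<lambda>n. 2 * cos (sqrt (T n)) - 2 + t n) \<in> O_pow (- 1 - \<nu> / 2 - \<epsilon>)"
    by (rule O_pow_mono) (use \<epsilon>(5) in \<open>simp add: algebra_simps\<close>)
  have sq: "1 / real n ^ 2 = real n powr (- 2)" for n
    by (cases "n = 0") (auto simp: powr_minus powr_numeral divide_inverse)
  have inv: "t n = - (2 * \<beta> - 2 * \<alpha> + \<sigma>) / real n + \<gamma> * x * real n powr (- \<sigma>)" for n
    by (simp add: t_def small_t_def \<tau>)
  have "jacobi_ansatz a b x (jost_ansatz \<gamma> (rho \<sigma>) (\<lambda>n. \<gamma> * (\<Sum>m=N..n. sqrt (T m)))) (sqrt c)"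
    by (rule jacobi_ansatz_jost[OF g \<nu> \<epsilon>(1,2) rho_min[of \<sigma>, folded \<nu>_def] a_pos a[unfolded sq] b[unfolded sq] inv T(1) c(1) T(2) pos cos])
  moreover have "jost_phase \<gamma> \<sigma> \<tau> L N x = (\<lambda>n. \<gamma> * (\<Sum>m=N..n. sqrt (T m)))"
    by (simp add: jost_phase_def bigT fun_eq_iff)
  ultimately show ?thesis by auto
qed

theorem theorem6p11:
  fixes \<gamma> \<sigma> \<alpha> \<beta> \<tau> x \<eta> :: real and a b :: "nat \<Rightarrow> real" and L N :: nat
  assumes "\<gamma> \<in> {1, -1}"
    and "0 < \<sigma>" and "\<sigma> \<le> 3 / 2"
    and "\<And>n. a n > 0"
    and "(\<lambda>n. a n / real n powr \<sigma> - (1 + \<alpha> / real n)) \<in> O(\<lambda>n. 1 / real n ^ 2)"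
    and "(\<lambda>n. b n / (2 * \<gamma> * real n powr \<sigma>) - (1 + \<beta> / real n)) \<in> O(\<lambda>n. 1 / real n ^ 2)"
    and "\<tau> = 2 * \<beta> - 2 * \<alpha> + \<sigma>"
    and "(1 < \<sigma> \<and> \<tau> < 0) \<or> (\<sigma> < 1 \<and> \<gamma> * x > 0) \<or> (\<sigma> = 1 \<and> \<gamma> * x > \<tau>)"
    and "L \<ge> 1" and "\<sigma> < 1 \<Longrightarrow> (real L + 1 / 2) * \<sigma> > 1"
    and "N \<ge> 1" and "\<And>m. m \<ge> N \<Longrightarrow> big_T \<sigma> \<tau> L m (\<gamma> * x) > 0"
    and "is_eta \<gamma> \<sigma> \<tau> L N a b x \<eta>"
  shows "jost_w \<gamma> \<sigma> \<tau> L N a b x > 0 \<and>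
    (\<exists>\<epsilon>. \<epsilon> \<longlonglongrightarrow> 0 \<and>
      (\<forall>\<^sub>F n in sequentially.
         orthopoly a b x n =
           kappa \<gamma> \<sigma> \<tau> L N a b x / jost_w \<gamma> \<sigma> \<tau> L N a b x * (- \<gamma>) ^ n * real n powr (- rho \<sigma>) *
             (sin (jost_phase \<gamma> \<sigma> \<tau> L N x n - \<eta>) + \<epsilon> n)))"
proof -
  define \<Phi> where "\<Phi> = jost_phase \<gamma> \<sigma> \<tau> L N x"
  define Q where "Q = jost_ansatz \<gamma> (rho \<sigma>) \<Phi>"
  define f where "f = jost_plus \<gamma> \<sigma> \<tau> L N a b x"
  define \<kappa> where "\<kappa> = kappa \<gamma> \<sigma> \<tau> L N a b x"
  define P where "P = orthopoly a b x"
  obtain w where "jacobi_ansatz a b x Q w"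
    using jacobi_ansatz_of_assumptions[OF assms(1,2,4-10,12)] unfolding Q_def \<Phi>_def by blast
  then interpret jacobi_ansatz a b x Q w .
  have jost: "is_jost \<gamma> \<sigma> \<tau> L N a b x F \<longleftrightarrow> jacobi_solution a b x F \<and> F \<sim>[sequentially] Q" for F
    by (simp add: is_jost_def Q_def \<Phi>_def jost_ansatz_def[abs_def])
  have "is_jost \<gamma> \<sigma> \<tau> L N a b x f"
  proof -
    have "\<exists>!F. is_jost \<gamma> \<sigma> \<tau> L N a b x F" unfolding jost by (rule ex1_jost)
    then show ?thesis unfolding f_def jost_plus_def by (rule theI')
  qed
  then have f: "jacobi_solution a b x f" "f \<sim>[sequentially] Q" by (simp_all add: jost)
  have w: "jost_w \<gamma> \<sigma> \<tau> L N a b x = w"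
    using wronskian_jost_cnj[OF f]
    by (simp add: jost_w_def f_def[symmetric] jost_minus_def[abs_def])
  define \<Omega> where "\<Omega> = wronskian a (\<lambda>n. of_real (P n)) f"
  have \<Omega>: "\<Omega> = of_real \<kappa> * cis \<eta>"
    using assms(13) by (simp add: is_eta_def Omega_plus_def \<Omega>_def P_def f_def \<kappa>_def cis_conv_exp)
  have P: "jacobi_solution a b x (\<lambda>n. of_real (P n))"
    unfolding P_def by (rule jacobi_solution_orthopoly[OF assms(4)])
  have "P 0 \<noteq> 0" by (simp add: P_def)
  note lim = real_solution_limits[OF P this f, folded \<Omega>_def]
  have \<kappa>: "\<kappa> \<noteq> 0" using lim(1) \<Omega> by auto
  define \<delta> where "\<delta> n = P n / norm (Q n) + Im (\<Omega> * cnj (sgn (Q n))) / w" for n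
  \<comment> \<open>Division by the amplitude is possible as \<open>\<kappa> \<noteq> 0\<close>; the sign \<open>(-\<gamma>)\<^sup>n\<close> is its own inverse.\<close>
  define \<epsilon> where "\<epsilon> n = w / \<kappa> * (- \<gamma>) ^ n * \<delta> n" for n
  have "\<delta> \<longlonglongrightarrow> 0" using lim(2) by (simp add: \<delta>_def[abs_def])
  then have "(\<lambda>n. \<bar>w / \<kappa>\<bar> * \<bar>\<delta> n\<bar>) \<longlonglongrightarrow> 0"
    by (intro tendsto_mult_right_zero tendsto_rabs_zero)
  then have "\<epsilon> \<longlonglongrightarrow> 0"
    by (rule Lim_null_comparison[rotated])
       (use assms(1) in \<open>auto simp: \<epsilon>_def abs_mult power_abs intro!: always_eventually\<close>)
  moreover have "\<forall>\<^sub>F n in sequentially. P n =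
      \<kappa> / w * (- \<gamma>) ^ n * real n powr (- rho \<sigma>) * (sin (\<Phi> n - \<eta>) + \<epsilon> n)"
    using eventually_gt_at_top[of 0]
  proof eventually_elim
    case (elim n)
    define r where "r = real n powr (- rho \<sigma>)"
    have r: "r > 0" using elim by (simp add: r_def)
    have s2: "(- \<gamma>) ^ n * (- \<gamma>) ^ n = 1"
      using assms(1) by (auto simp: power_mult_distrib[symmetric])
    have nQ: "norm (Q n) = r" unfolding Q_def r_def by (rule norm_jost_ansatz[OF assms(1)])
    have "Q n = of_real r * (of_real ((- \<gamma>) ^ n) * cis (\<Phi> n))"
      by (simp add: Q_def jost_ansatz_def r_def cis_conv_exp)
    then have sQ: "sgn (Q n) = of_real ((- \<gamma>) ^ n) * cis (\<Phi> n)"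
      using r unfolding sgn_div_norm nQ by (simp add: scaleR_conv_of_real field_simps)
    have "\<Omega> * cnj (sgn (Q n)) = of_real (\<kappa> * (- \<gamma>) ^ n) * cis (\<eta> - \<Phi> n)"
      unfolding sQ \<Omega> by (simp add: cis_cnj cis_mult mult_ac)
    then have "Im (\<Omega> * cnj (sgn (Q n))) = \<kappa> * (- \<gamma>) ^ n * sin (\<eta> - \<Phi> n)" by simp
    moreover have "sin (\<eta> - \<Phi> n) = - sin (\<Phi> n - \<eta>)" by (metis minus_diff_eq sin_minus)
    ultimately have \<delta>n: "\<delta> n = P n / r - \<kappa> * (- \<gamma>) ^ n * sin (\<Phi> n - \<eta>) / w" by (simp add: \<delta>_def nQ)
    have "\<kappa> / w * (- \<gamma>) ^ n * r * (sin (\<Phi> n - \<eta>) + \<epsilon> n) =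
      \<kappa> / w * (- \<gamma>) ^ n * r * sin (\<Phi> n - \<eta>) + r * ((- \<gamma>) ^ n * (- \<gamma>) ^ n) * \<delta> n"
      using \<kappa> w_pos by (simp add: \<epsilon>_def field_simps)
    also have "\<dots> = P n" unfolding s2 \<delta>n using r w_pos by (simp add: field_simps)
    finally show ?case by (simp add: r_def)
  qed
  ultimately show ?thesis
    using w_pos unfolding w \<kappa>_def[symmetric] P_def[symmetric] \<Phi>_def[symmetric] by blast
qed

end
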